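(* Let $\mathcal B$ be a set of subsets of $V$ that has the good closure property. Let $I=(X_i\geq\varphi_i)_{1\leq i\leq n}$ be a system of inequalities over $\Omega=(\Omega_v,\Omega_p)$ with $\Omega_v=\{X_1,\dots,X_n\}$, and let $\mathbf P\in(2^V)^{\Omega_p}$ be an assignment such that $\mathbf P(P)\in\mathcal B$ for every $P\in\Omega_p$. Let $\mathbf X=(\mathbf X_1,\dots,\mathbf X_n)$ be the unique smallest solution of $I$ under $\mathbf P$. Then $\mathbf X_i\in\mathcal B$ for each $1\leq i\leq n$. Moreover, if $\mathcal B$ has the effective good closure property, then there exists an effective algorithm which takes as input the system $I$ and descriptions of the sets $\mathbf P(P)$, $P\in\Omega_p$, and produces as output descriptions of the sets $\mathbf X_i$, $1\leq i\leq n$.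
   Context: $V$ is a finite-dimensional real vector space, $2^V$ its set of subsets, $\mathcal C(V)$ its set of convex subsets (including $\emptyset$), $\operatorname{conv}$ the convex hull. For $A,B\subset V$ and $\rho\in\mathbb R$: $\rho\cdot A=\{\rho x: x\in A\}$; $A+B=\{a+b: a\in A,b\in B\}$; $A\,\widehat\oplus\,B=A\cup B$; and the positive geometric join is $A\,\mathring\star\,B=\{\lambda a+(1-\lambda)b: 0<\lambda<1,\ a\in A,\ b\in B\}$ (an associative commutative operation). Syntax. $\Omega_v$ (variables) and $\Omega_p$ (parameters) are disjoint finite sets of symbols, $\Omega=(\Omega_v,\Omega_p)$. $\mathrm{CL}(\Omega)$ is the set of formal convex linear combinations $E=\sum_{\omega\in\Omega_v\cup\Omega_p}\lambda_\omega\cdot\omega$ with $\lambda_\omega\geq0$, $\sum\lambda_\omega=1$. A monomial over $\Omega$ is a formal product $E_1\mathring\star\cdots\mathring\star E_k$, $k\geq1$, of distinct elements of $\mathrm{CL}(\Omega)$, up to permutation of factors (formally $E\mathring\star E=E$). A polynomial over $\Omega$ is a formal sum $M_1\widehat\oplus\cdots\widehat\oplus M_k$, $k\geq0$, of distinct monomials, up to permutation (formally $M\widehat\oplus M=M$); $\mathbb P[\Omega]$ is the set of polynomials. A system of inequalities over $\Omega$ is a tuple $(X_i\geq\varphi_i)_{1\leq i\leq n}$ with $\Omega_v=\{X_1,\dots,X_n\}$ and $\varphi_i\in\mathbb P[\Omega]$. Evaluation. For $\mathbf X\in\mathcal C(V)^{\Omega_v}$ and $\mathbf P\in(2^V)^{\Omega_p}$: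 $\operatorname{eval}(E;\mathbf X,\mathbf P)=\sum_{X\in\Omega_v,\lambda_X>0}\lambda_X\cdot\mathbf X(X)+\sum_{P\in\Omega_p,\lambda_P>0}\lambda_P\cdot\mathbf P(P)$ (Minkowski sums); for a monomial, $\operatorname{eval}$ is the positive geometric join of the evaluations of its distinct factors; for a polynomial, the union of the evaluations of its monomials (the empty polynomial evaluates to $\emptyset$). Solutions. Write $\mathbf X_i=\mathbf X(X_i)$. $\mathbf X\in\mathcal C(V)^{\Omega_v}$ is a solution of $I$ under $\mathbf P$ if $\mathbf X_i\supseteq\operatorname{eval}(\varphi_i;\mathbf X,\mathbf P)$ for all $i$. The smallest solution is the minimum solution under componentwise inclusion, i.e. the componentwise intersection of all solutions (it is always itself a solution). Good closure property. A set $\mathcal B$ of subsets of $V$ containing $\emptyset$ has the good closure property if it is closed under finite unions, nonnegative scalar multiplication, Minkowski sums, positive geometric joins, and convex hulls. It has the effective good closure property if in addition there is an algorithm which, given descriptions of $B_1,\dots,B_m\in\mathcal B$ and reals $b_1,\dots,b_m\geq0$, outputs descriptions of $\bigcup_iB_i$, $\sum_iB_i$, $(b_1\cdot B_1,\dots,b_m\cdot B_m)$, $B_1\mathring\star\cdots\mathring\star B_m$ and $\operatorname{conv}(B_1\cup\cdots\cup B_m)$. "Algorithm" means an algorithm performing arithmetic operations and comparisons on real numbers, with sets described by quantifier-free formulas with atoms $P=0$, $P>0$, $P$ a real polynomial. *)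

theory Defs
  imports "HOL-Analysis.Analysis" "HOL-Library.Set_Algebras"
begin

section \<open>Operations on subsets of a real vector space\<close>

text \<open>Minkowski sums are the library sums of sets; in particular
  \<open>\<Sum>i\<in>J. A i\<close> is an iterated Minkowski sum, equal to \<open>{0}\<close> for empty \<open>J\<close>.\<close>

abbreviation scale_set :: "real \<Rightarrow> 'v::real_vector set \<Rightarrow> 'v set" where
  "scale_set r A \<equiv> (*\<^sub>R) r ` A"

definition pos_join :: "'v::real_vector set \<Rightarrow> 'v set \<Rightarrow> 'v set" where
  "pos_join A B = {l *\<^sub>R a + (1 - l) *\<^sub>R b | l a b. 0 < l \<and> l < 1 \<and> a \<in> A \<and> b \<in> B}"

text \<open>The join has no neutral element; the value on the empty list is junk and never used.\<close>

fun pos_joins :: "'v::real_vector set list \<Rightarrow> 'v set" where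
  "pos_joins [] = {}"
| "pos_joins [A] = A"
| "pos_joins (A # B # As) = pos_join A (pos_joins (B # As))"

lemma pos_joinI:
  assumes "0 < l" "l < 1" "a \<in> A" "b \<in> B"
  shows "l *\<^sub>R a + (1 - l) *\<^sub>R b \<in> pos_join A B"
  unfolding pos_join_def using assms by blast

lemma pos_join_mono: "A \<subseteq> A' \<Longrightarrow> B \<subseteq> B' \<Longrightarrow> pos_join A B \<subseteq> pos_join A' B'"
  unfolding pos_join_def by blast

lemma pos_join_commute_subset: "pos_join A B \<subseteq> pos_join B A"
proof
  fix x assume "x \<in> pos_join A B"
  then obtain l a b where *: "x = l *\<^sub>R a + (1 - l) *\<^sub>R b" "0 < l" "l < 1" "a \<in> A" "b \<in> B"
    unfolding pos_join_def by blast
  have "(1 - l) *\<^sub>R b + (1 - (1 - l)) *\<^sub>R a \<in> pos_join B A"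
    using * by (intro pos_joinI) auto
  then show "x \<in> pos_join B A" using * by (simp add: add.commute)
qed

lemma pos_join_commute: "pos_join A B = pos_join B A"
  using pos_join_commute_subset by blast

lemma pos_join_assoc_subset: "pos_join (pos_join A B) C \<subseteq> pos_join A (pos_join B C)"
proof
  fix x assume "x \<in> pos_join (pos_join A B) C"
  then obtain l m a b c where l: "0 < l" "l < 1" and m: "0 < m" "m < 1"
    and abc: "a \<in> A" "b \<in> B" "c \<in> C"
    and x: "x = l *\<^sub>R (m *\<^sub>R a + (1 - m) *\<^sub>R b) + (1 - l) *\<^sub>R c"
    unfolding pos_join_def by blast
  define k where "k = l * (1 - m) / (1 - l * m)"
  have lm: "0 < l * m" "l * m < 1"
    using l m mult_strict_mono[of l 1 m 1] by auto
  have "l * (1 - m) < 1 - l * m" using l by (simp add: algebra_simps)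
  then have k: "0 < k" "k < 1" using l m lm unfolding k_def by auto
  have e1: "(1 - l * m) * k = l * (1 - m)" using lm unfolding k_def by simp
  have e2: "(1 - l * m) * (1 - k) = 1 - l"
    using e1 by (simp add: algebra_simps)
  have "(l * m) *\<^sub>R a + (1 - l * m) *\<^sub>R (k *\<^sub>R b + (1 - k) *\<^sub>R c)
        \<in> pos_join A (pos_join B C)"
    using lm k abc by (intro pos_joinI) auto
  moreover have "x = (l * m) *\<^sub>R a + (1 - l * m) *\<^sub>R (k *\<^sub>R b + (1 - k) *\<^sub>R c)"
    unfolding x scaleR_add_right scaleR_scaleR e1 e2 by (simp add: add.assoc)
  ultimately show "x \<in> pos_join A (pos_join B C)" by simp
qed

lemma pos_join_assoc: "pos_join (pos_join A B) C = pos_join A (pos_join B C)"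
proof
  have "pos_join A (pos_join B C) = pos_join (pos_join C B) A"
    by (simp add: pos_join_commute)
  also have "\<dots> \<subseteq> pos_join C (pos_join B A)" by (rule pos_join_assoc_subset)
  also have "\<dots> = pos_join (pos_join A B) C" by (simp add: pos_join_commute)
  finally show "pos_join A (pos_join B C) \<subseteq> pos_join (pos_join A B) C" .
qed (rule pos_join_assoc_subset)

lemma pos_joins_Cons: "As \<noteq> [] \<Longrightarrow> pos_joins (A # As) = pos_join A (pos_joins As)"
  by (cases As) auto

lemma pos_joins_move:
  "xs @ ys \<noteq> [] \<Longrightarrow> pos_joins (xs @ A # ys) = pos_join A (pos_joins (xs @ ys))"
proof (induction xs)
  case Nil
  then show ?case by (simp add: pos_joins_Cons)
next
  case (Cons B xs)
  show ?case
  proof (cases "xs @ ys = []")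
    case True
    then show ?thesis by (simp add: pos_join_commute)
  next
    case False
    have "pos_joins ((B # xs) @ A # ys) = pos_join B (pos_join A (pos_joins (xs @ ys)))"
      using Cons.IH[OF False] by (simp add: pos_joins_Cons)
    also have "\<dots> = pos_join A (pos_join B (pos_joins (xs @ ys)))"
      by (metis pos_join_assoc pos_join_commute)
    finally show ?thesis using False by (simp add: pos_joins_Cons)
  qed
qed

lemma pos_joins_mset: "mset As = mset Bs \<Longrightarrow> pos_joins As = pos_joins Bs"
proof (induction As arbitrary: Bs)
  case Nil
  then show ?case by simp
next
  case (Cons A As)
  then have "A \<in> set Bs" by (metis list.set_intros(1) mset_eq_setD)
  then obtain ys zs where Bs: "Bs = ys @ A # zs" by (meson split_list)
  then have eq: "mset As = mset (ys @ zs)" using Cons.prems by simp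
  show ?case
  proof (cases "As = []")
    case True
    then show ?thesis using eq Bs by simp
  next
    case False
    moreover from this have "ys @ zs \<noteq> []" using eq by auto
    ultimately show ?thesis
      using Cons.IH[OF eq] unfolding Bs by (simp add: pos_joins_Cons pos_joins_move)
  qed
qed

lemma pos_joins_mono: "list_all2 (\<subseteq>) As Bs \<Longrightarrow> pos_joins As \<subseteq> pos_joins Bs"
proof (induction As Bs rule: list_all2_induct)
  case Nil
  then show ?case by simp
next
  case (Cons A As B Bs)
  show ?case
  proof (cases "As = []")
    case True
    then show ?thesis using Cons by simp
  next
    case False
    moreover from this have "Bs \<noteq> []" using Cons.hyps by auto
    ultimately show ?thesis using Cons by (simp add: pos_joins_Cons pos_join_mono)
  qed
qed

definition good_closure :: "'v::real_vector set set \<Rightarrow> bool" where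
  "good_closure \<B> \<longleftrightarrow>
     {} \<in> \<B> \<and>
     (\<forall>A\<in>\<B>. \<forall>B\<in>\<B>. A \<union> B \<in> \<B>) \<and>
     (\<forall>A\<in>\<B>. \<forall>r\<ge>0. scale_set r A \<in> \<B>) \<and>
     (\<forall>A\<in>\<B>. \<forall>B\<in>\<B>. A + B \<in> \<B>) \<and>
     (\<forall>A\<in>\<B>. \<forall>B\<in>\<B>. pos_join A B \<in> \<B>) \<and>
     (\<forall>A\<in>\<B>. convex hull A \<in> \<B>)"


section \<open>Systems of inequalities\<close>

text \<open>All symbols come from one countable pool. A formal convex combination is its family of
  coefficients, extended by 0 outside the symbols under consideration. Formal products and formal
  sums of distinct items, up to permutation, are finite sets of items.\<close>

type_synonym symb = nat
type_synonym lincomb = "symb \<Rightarrow> real"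
type_synonym monomial = "lincomb set"
type_synonym polynomial = "monomial set"
type_synonym system = "(symb \<times> polynomial) list"

definition CL :: "symb set \<Rightarrow> lincomb set" where
  "CL \<Omega> = {E. (\<forall>\<omega>. 0 \<le> E \<omega>) \<and> (\<forall>\<omega>. \<omega> \<notin> \<Omega> \<longrightarrow> E \<omega> = 0) \<and> (\<Sum>\<omega>\<in>\<Omega>. E \<omega>) = 1}"

definition monomials :: "symb set \<Rightarrow> monomial set" where
  "monomials \<Omega> = {M. finite M \<and> M \<noteq> {} \<and> M \<subseteq> CL \<Omega>}"

definition polynomials :: "symb set \<Rightarrow> polynomial set" where
  "polynomials \<Omega> = {\<phi>. finite \<phi> \<and> \<phi> \<subseteq> monomials \<Omega>}"

definition vars :: "system \<Rightarrow> symb set" where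
  "vars I = fst ` set I"

definition is_system :: "symb set \<Rightarrow> system \<Rightarrow> bool" where
  "is_system \<Omega>p I \<longleftrightarrow>
     distinct (map fst I) \<and> finite \<Omega>p \<and> vars I \<inter> \<Omega>p = {} \<and>
     (\<forall>(X, \<phi>)\<in>set I. \<phi> \<in> polynomials (vars I \<union> \<Omega>p))"

text \<open>Assignments are total functions, of which only the values on the variables and on the
  parameters, respectively, are used.\<close>

definition eval_lincomb ::
  "symb set \<Rightarrow> symb set \<Rightarrow> (symb \<Rightarrow> 'v::real_vector set) \<Rightarrow> (symb \<Rightarrow> 'v set) \<Rightarrow> lincomb \<Rightarrow> 'v set"
where
  "eval_lincomb \<Omega>v \<Omega>p X P E =
     (\<Sum>\<omega>\<in>{\<omega>\<in>\<Omega>v. E \<omega> > 0}. scale_set (E \<omega>) (X \<omega>)) +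
     (\<Sum>\<omega>\<in>{\<omega>\<in>\<Omega>p. E \<omega> > 0}. scale_set (E \<omega>) (P \<omega>))"

text \<open>The result does not depend on the chosen enumeration of the factors; see
  \<open>eval_monomial_eq\<close> below.\<close>

definition eval_monomial ::
  "symb set \<Rightarrow> symb set \<Rightarrow> (symb \<Rightarrow> 'v::real_vector set) \<Rightarrow> (symb \<Rightarrow> 'v set) \<Rightarrow> monomial \<Rightarrow> 'v set"
where
  "eval_monomial \<Omega>v \<Omega>p X P M =
     pos_joins (map (eval_lincomb \<Omega>v \<Omega>p X P) (SOME Es. distinct Es \<and> set Es = M))"

definition eval_polynomial ::
  "symb set \<Rightarrow> symb set \<Rightarrow> (symb \<Rightarrow> 'v::real_vector set) \<Rightarrow> (symb \<Rightarrow> 'v set) \<Rightarrow> polynomial \<Rightarrow> 'v set"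
where
  "eval_polynomial \<Omega>v \<Omega>p X P \<phi> = (\<Union>M\<in>\<phi>. eval_monomial \<Omega>v \<Omega>p X P M)"

definition is_solution ::
  "symb set \<Rightarrow> system \<Rightarrow> (symb \<Rightarrow> 'v::real_vector set) \<Rightarrow> (symb \<Rightarrow> 'v set) \<Rightarrow> bool"
where
  "is_solution \<Omega>p I P X \<longleftrightarrow>
     (\<forall>x\<in>vars I. convex (X x)) \<and>
     (\<forall>(x, \<phi>)\<in>set I. eval_polynomial (vars I) \<Omega>p X P \<phi> \<subseteq> X x)"

definition is_smallest_solution ::
  "symb set \<Rightarrow> system \<Rightarrow> (symb \<Rightarrow> 'v::real_vector set) \<Rightarrow> (symb \<Rightarrow> 'v set) \<Rightarrow> bool"
where
  "is_smallest_solution \<Omega>p I P X \<longleftrightarrow>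
     is_solution \<Omega>p I P X \<and>
     (\<forall>Y. is_solution \<Omega>p I P Y \<longrightarrow> (\<forall>x\<in>vars I. X x \<subseteq> Y x))"

lemma eval_monomial_eq:
  assumes "distinct Es" "set Es = M"
  shows "eval_monomial \<Omega>v \<Omega>p X P M = pos_joins (map (eval_lincomb \<Omega>v \<Omega>p X P) Es)"
proof -
  let ?Fs = "SOME Es. distinct Es \<and> set Es = M"
  have "distinct ?Fs \<and> set ?Fs = M" using someI[of "\<lambda>Es. distinct Es \<and> set Es = M" Es] assms by simp
  then have "mset ?Fs = mset Es" using assms set_eq_iff_mset_eq_distinct by blast
  then show ?thesis unfolding eval_monomial_def by (intro pos_joins_mset) simp
qed

lemma set_sum_mono:
  fixes F G :: "'b \<Rightarrow> 'v::real_vector set"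
  assumes "\<And>i. i \<in> J \<Longrightarrow> F i \<subseteq> G i"
  shows "(\<Sum>i\<in>J. F i) \<subseteq> (\<Sum>i\<in>J. G i)"
  using assms by (induction J rule: infinite_finite_induct) (simp_all add: set_plus_mono2)

lemma eval_lincomb_mono:
  assumes "\<And>x. x \<in> \<Omega>v \<Longrightarrow> X x \<subseteq> Y x"
  shows "eval_lincomb \<Omega>v \<Omega>p X P E \<subseteq> eval_lincomb \<Omega>v \<Omega>p Y P E"
  unfolding eval_lincomb_def using assms
  by (intro set_plus_mono2 set_sum_mono image_mono) auto

lemma eval_polynomial_mono:
  assumes "\<And>x. x \<in> \<Omega>v \<Longrightarrow> X x \<subseteq> Y x"
  shows "eval_polynomial \<Omega>v \<Omega>p X P \<phi> \<subseteq> eval_polynomial \<Omega>v \<Omega>p Y P \<phi>"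
  unfolding eval_polynomial_def eval_monomial_def using assms
  by (intro UN_mono pos_joins_mono)
     (auto simp: list_all2_conv_all_nth intro: subsetD[OF eval_lincomb_mono[OF assms]])

lemma smallest_solution_exists:
  "is_smallest_solution \<Omega>p I P (\<lambda>x. \<Inter>{Y x | Y. is_solution \<Omega>p I P Y})"
proof -
  define X where "X = (\<lambda>x. \<Inter>{Y x | Y. is_solution \<Omega>p I P Y})"
  have le: "X x \<subseteq> Y x" if "is_solution \<Omega>p I P Y" for x Y
    unfolding X_def using that by blast
  have "convex (X x)" if "x \<in> vars I" for x
    unfolding X_def using that by (auto simp: is_solution_def intro!: convex_Inter)
  moreover have "eval_polynomial (vars I) \<Omega>p X P \<phi> \<subseteq> X x" if mem: "(x, \<phi>) \<in> set I" for x \<phi>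
  proof -
    have "eval_polynomial (vars I) \<Omega>p X P \<phi> \<subseteq> Y x" if "is_solution \<Omega>p I P Y" for Y
    proof -
      have "eval_polynomial (vars I) \<Omega>p X P \<phi> \<subseteq> eval_polynomial (vars I) \<Omega>p Y P \<phi>"
        using le[OF that] by (rule eval_polynomial_mono)
      also have "\<dots> \<subseteq> Y x" using that mem unfolding is_solution_def by blast
      finally show ?thesis .
    qed
    then show ?thesis unfolding X_def by blast
  qed
  ultimately have "is_smallest_solution \<Omega>p I P X"
    using le unfolding is_smallest_solution_def is_solution_def[of \<Omega>p I P X] by blast
  then show ?thesis unfolding X_def .
qed

lemma smallest_solution_unique:
  "is_smallest_solution \<Omega>p I P X \<Longrightarrow> is_smallest_solution \<Omega>p I P Y \<Longrightarrow> x \<in> vars I \<Longrightarrow> X x = Y x"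
  unfolding is_smallest_solution_def by blast


section \<open>Algorithms over the real numbers\<close>

text \<open>Data are binary trees whose leaves are real numbers or an end-of-list marker. The only
  operations on numbers are exact arithmetic and comparison, and the only constants are 0 and 1,
  so that a program is a finite text.\<close>

datatype val = Num real | Nil_val | Pair_val val val

text \<open>Every program computes a partial function of one argument. \<open>Rec b\<close> runs \<open>b\<close>, and \<open>Call\<close>
  inside \<open>b\<close> is a recursive call of the innermost enclosing \<open>Rec\<close>.\<close>

datatype prog =
    Input
  | Nil_prog | Zero | One
  | Pair_prog prog prog | First prog | Second prog
  | Is_Num prog | Is_Pair prog
  | Add prog prog | Sub prog prog | Mul prog prog | Div prog prog
  | Less prog prog
  | Cond prog prog prog
  | Seq prog prog
  | Rec prog | Call

abbreviation bool_val :: "bool \<Rightarrow> val" where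
  "bool_val b \<equiv> Num (if b then 1 else 0)"

text \<open>\<open>exec b p x y\<close>: where \<open>b\<close> is the body of the enclosing recursion, \<open>p\<close> halts on input \<open>x\<close>
  with output \<open>y\<close>. There is no output if an operation is applied to data of the wrong shape, if a
  division by 0 occurs, or if the recursion does not terminate.\<close>

inductive exec :: "prog \<Rightarrow> prog \<Rightarrow> val \<Rightarrow> val \<Rightarrow> bool" where
  Input: "exec b Input x x"
| Nil: "exec b Nil_prog x Nil_val"
| Zero: "exec b Zero x (Num 0)"
| One: "exec b One x (Num 1)"
| Pair: "exec b p x u \<Longrightarrow> exec b q x v \<Longrightarrow> exec b (Pair_prog p q) x (Pair_val u v)"
| First: "exec b p x (Pair_val u v) \<Longrightarrow> exec b (First p) x u"
| Second: "exec b p x (Pair_val u v) \<Longrightarrow> exec b (Second p) x v"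
| Is_Num: "exec b p x u \<Longrightarrow> exec b (Is_Num p) x (bool_val (\<exists>r. u = Num r))"
| Is_Pair: "exec b p x u \<Longrightarrow> exec b (Is_Pair p) x (bool_val (\<exists>v w. u = Pair_val v w))"
| Add: "exec b p x (Num r) \<Longrightarrow> exec b q x (Num s) \<Longrightarrow> exec b (Add p q) x (Num (r + s))"
| Sub: "exec b p x (Num r) \<Longrightarrow> exec b q x (Num s) \<Longrightarrow> exec b (Sub p q) x (Num (r - s))"
| Mul: "exec b p x (Num r) \<Longrightarrow> exec b q x (Num s) \<Longrightarrow> exec b (Mul p q) x (Num (r * s))"
| Div: "exec b p x (Num r) \<Longrightarrow> exec b q x (Num s) \<Longrightarrow> s \<noteq> 0 \<Longrightarrow>
    exec b (Div p q) x (Num (r / s))"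
| Less: "exec b p x (Num r) \<Longrightarrow> exec b q x (Num s) \<Longrightarrow> exec b (Less p q) x (bool_val (r < s))"
| Cond_true: "exec b c x (Num r) \<Longrightarrow> r \<noteq> 0 \<Longrightarrow> exec b p x y \<Longrightarrow> exec b (Cond c p q) x y"
| Cond_false: "exec b c x (Num 0) \<Longrightarrow> exec b q x y \<Longrightarrow> exec b (Cond c p q) x y"
| Seq: "exec b p x y \<Longrightarrow> exec b q y z \<Longrightarrow> exec b (Seq p q) x z"
| Rec: "exec p p x y \<Longrightarrow> exec b (Rec p) x y"
| Call: "exec b b x y \<Longrightarrow> exec b Call x y"

definition computes :: "prog \<Rightarrow> val \<Rightarrow> val \<Rightarrow> bool" where
  "computes p x y \<longleftrightarrow> exec p p x y"

inductive_cases execE: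
  "exec b Input x y"
  "exec b Nil_prog x y"
  "exec b Zero x y"
  "exec b One x y"
  "exec b (Pair_prog p q) x y"
  "exec b (First p) x y"
  "exec b (Second p) x y"
  "exec b (Is_Num p) x y"
  "exec b (Is_Pair p) x y"
  "exec b (Add p q) x y"
  "exec b (Sub p q) x y"
  "exec b (Mul p q) x y"
  "exec b (Div p q) x y"
  "exec b (Less p q) x y"
  "exec b (Cond c p q) x y"
  "exec b (Seq p q) x y"
  "exec b (Rec p) x y"
  "exec b Call x y"

lemma exec_deterministic: "exec b p x y \<Longrightarrow> exec b p x z \<Longrightarrow> y = z"
proof (induction arbitrary: z rule: exec.induct)
  case Input
  from Input.prems show ?case
    by (rule execE) simp
next
  case Nil
  from Nil.prems show ?case
    by (rule execE) simp
next
  case Zero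
  from Zero.prems show ?case
    by (rule execE) simp
next
  case One
  from One.prems show ?case
    by (rule execE) simp
next
  case Pair
  from Pair.prems show ?case
    by (rule execE) (use Pair.IH in \<open>metis val.inject\<close>)
next
  case First
  from First.prems show ?case
    by (rule execE) (use First.IH in \<open>metis val.inject\<close>)
next
  case Second
  from Second.prems show ?case
    by (rule execE) (use Second.IH in \<open>metis val.inject\<close>)
next
  case Is_Num
  from Is_Num.prems show ?case
    by (rule execE) (use Is_Num.IH in \<open>metis val.inject\<close>)
next
  case Is_Pair
  from Is_Pair.prems show ?case
    by (rule execE) (use Is_Pair.IH in \<open>metis val.inject\<close>)
next
  case Add
  from Add.prems show ?case
    by (rule execE) (use Add.IH in \<open>metis val.inject\<close>)
next
  case Sub
  from Sub.prems show ?case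
    by (rule execE) (use Sub.IH in \<open>metis val.inject\<close>)
next
  case Mul
  from Mul.prems show ?case
    by (rule execE) (use Mul.IH in \<open>metis val.inject\<close>)
next
  case Div
  from Div.prems show ?case
    by (rule execE) (use Div.IH in \<open>metis val.inject\<close>)
next
  case Less
  from Less.prems show ?case
    by (rule execE) (use Less.IH in \<open>metis val.inject\<close>)
next
  case Cond_true
  from Cond_true.prems show ?case
    by (rule execE) (use Cond_true.IH Cond_true.hyps in \<open>metis val.inject\<close>)+
next
  case Cond_false
  from Cond_false.prems show ?case
    by (rule execE) (use Cond_false.IH in \<open>metis val.inject\<close>)+
next
  case Seq
  from Seq.prems show ?case
    by (rule execE) (use Seq.IH in \<open>metis val.inject\<close>)
next
  case Rec
  from Rec.prems show ?case
    by (rule execE) (use Rec.IH in \<open>metis val.inject\<close>)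
next
  case Call
  from Call.prems show ?case
    by (rule execE) (use Call.IH in \<open>metis val.inject\<close>)
qed

lemma computes_deterministic: "computes p x y \<Longrightarrow> computes p x z \<Longrightarrow> y = z"
  unfolding computes_def by (rule exec_deterministic)


section \<open>Descriptions of sets and systems as data\<close>

datatype real_poly =
    Const real | Coord nat | Plus real_poly real_poly | Times real_poly real_poly

datatype qf_formula =
    Eq0 real_poly | Gt0 real_poly | Neg qf_formula
  | Conj qf_formula qf_formula | Disj qf_formula qf_formula

fun poly_value :: "real_poly \<Rightarrow> (nat \<Rightarrow> real) \<Rightarrow> real" where
  "poly_value (Const c) t = c"
| "poly_value (Coord i) t = t i"
| "poly_value (Plus p q) t = poly_value p t + poly_value q t"
| "poly_value (Times p q) t = poly_value p t * poly_value q t"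

fun poly_coords :: "real_poly \<Rightarrow> nat set" where
  "poly_coords (Const c) = {}"
| "poly_coords (Coord i) = {i}"
| "poly_coords (Plus p q) = poly_coords p \<union> poly_coords q"
| "poly_coords (Times p q) = poly_coords p \<union> poly_coords q"

fun qf_holds :: "qf_formula \<Rightarrow> (nat \<Rightarrow> real) \<Rightarrow> bool" where
  "qf_holds (Eq0 p) t \<longleftrightarrow> poly_value p t = 0"
| "qf_holds (Gt0 p) t \<longleftrightarrow> poly_value p t > 0"
| "qf_holds (Neg f) t \<longleftrightarrow> \<not> qf_holds f t"
| "qf_holds (Conj f g) t \<longleftrightarrow> qf_holds f t \<and> qf_holds g t"
| "qf_holds (Disj f g) t \<longleftrightarrow> qf_holds f t \<or> qf_holds g t"

fun qf_coords :: "qf_formula \<Rightarrow> nat set" where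
  "qf_coords (Eq0 p) = poly_coords p"
| "qf_coords (Gt0 p) = poly_coords p"
| "qf_coords (Neg f) = qf_coords f"
| "qf_coords (Conj f g) = qf_coords f \<union> qf_coords g"
| "qf_coords (Disj f g) = qf_coords f \<union> qf_coords g"

fun list_val :: "val list \<Rightarrow> val" where
  "list_val [] = Nil_val"
| "list_val (x # xs) = Pair_val x (list_val xs)"

fun poly_val :: "real_poly \<Rightarrow> val" where
  "poly_val (Const c) = list_val [Num 0, Num c]"
| "poly_val (Coord i) = list_val [Num 1, Num (real i)]"
| "poly_val (Plus p q) = list_val [Num 2, poly_val p, poly_val q]"
| "poly_val (Times p q) = list_val [Num 3, poly_val p, poly_val q]"

fun qf_val :: "qf_formula \<Rightarrow> val" where
  "qf_val (Eq0 p) = list_val [Num 0, poly_val p]"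
| "qf_val (Gt0 p) = list_val [Num 1, poly_val p]"
| "qf_val (Neg f) = list_val [Num 2, qf_val f]"
| "qf_val (Conj f g) = list_val [Num 3, qf_val f, qf_val g]"
| "qf_val (Disj f g) = list_val [Num 4, qf_val f, qf_val g]"

text \<open>\<open>describes bs B c\<close>: \<open>c\<close> is the code of a quantifier-free formula that defines \<open>B\<close> in the
  coordinates given by the basis \<open>bs\<close>.\<close>

definition describes :: "'v::real_vector list \<Rightarrow> 'v set \<Rightarrow> val \<Rightarrow> bool" where
  "describes bs B c \<longleftrightarrow>
     (\<exists>f. qf_coords f \<subseteq> {..<length bs} \<and> c = qf_val f \<and>
          B = {x. qf_holds f (\<lambda>i. representation (set bs) x (bs ! i))})"

definition codes_list :: "('b \<Rightarrow> val \<Rightarrow> bool) \<Rightarrow> 'b list \<Rightarrow> val \<Rightarrow> bool" where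
  "codes_list R xs c \<longleftrightarrow> (\<exists>cs. list_all2 R xs cs \<and> c = list_val cs)"

text \<open>A finite set is given to an algorithm by listing its elements in an arbitrary order.\<close>

definition codes_set :: "('b \<Rightarrow> val \<Rightarrow> bool) \<Rightarrow> 'b set \<Rightarrow> val \<Rightarrow> bool" where
  "codes_set R A c \<longleftrightarrow> (\<exists>xs. distinct xs \<and> set xs = A \<and> codes_list R xs c)"

definition codes_lincomb :: "symb list \<Rightarrow> lincomb \<Rightarrow> val \<Rightarrow> bool" where
  "codes_lincomb ws E c \<longleftrightarrow>
     c = list_val (map (\<lambda>\<omega>. Pair_val (Num (real \<omega>)) (Num (E \<omega>))) ws)"

definition codes_polynomial :: "symb list \<Rightarrow> polynomial \<Rightarrow> val \<Rightarrow> bool" where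
  "codes_polynomial ws = codes_set (codes_set (codes_lincomb ws))"

text \<open>\<open>ps\<close> enumerates the parameters; each convex combination is coded by all of its coefficients,
  those of the variables first.\<close>

definition codes_system :: "symb list \<Rightarrow> system \<Rightarrow> val \<Rightarrow> bool" where
  "codes_system ps I c \<longleftrightarrow>
     codes_list (\<lambda>(x, \<phi>) d. \<exists>e. codes_polynomial (map fst I @ ps) \<phi> e \<and>
                                d = Pair_val (Num (real x)) e) I c"

definition codes_parameters ::
  "'v::real_vector list \<Rightarrow> symb list \<Rightarrow> (symb \<Rightarrow> 'v set) \<Rightarrow> val \<Rightarrow> bool" where
  "codes_parameters bs ps P c \<longleftrightarrow>
     codes_list (\<lambda>p d. \<exists>e. describes bs (P p) e \<and> d = Pair_val (Num (real p)) e) ps c"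

text \<open>The basis \<open>bs\<close> only fixes the coordinates that occur in descriptions. The algorithm is not
  asked to handle members of \<open>\<B>\<close> that have no description.\<close>

definition effective_good_closure :: "'v::real_vector list \<Rightarrow> 'v set set \<Rightarrow> bool" where
  "effective_good_closure bs \<B> \<longleftrightarrow>
     good_closure \<B> \<and>
     (\<exists>p. \<forall>Bs rs c.
        Bs \<noteq> [] \<and> set Bs \<subseteq> \<B> \<and> length rs = length Bs \<and> (\<forall>r\<in>set rs. 0 \<le> r) \<and>
        codes_list (describes bs) Bs c \<longrightarrow>
        (\<exists>c_union c_sum c_scaled c_join c_hull.
           computes p (Pair_val c (list_val (map Num rs)))
             (list_val [c_union, c_sum, c_scaled, c_join, c_hull]) \<and>
           describes bs (\<Union>(set Bs)) c_union \<and>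
           describes bs (sum_list Bs) c_sum \<and>
           codes_list (describes bs) (map2 scale_set rs Bs) c_scaled \<and>
           describes bs (pos_joins Bs) c_join \<and>
           describes bs (convex hull (\<Union>(set Bs))) c_hull))"

end

theory Submission
  imports Defs
begin

text \<open>Eliminate the variables one at a time. Up to convex hulls, substituting a polynomial into a
  polynomial gives a polynomial, so it suffices to solve \<open>X \<ge> M\<^sub>1 \<union> \<dots> \<union> M\<^sub>m\<close> for one variable, with
  convex sets in place of the other symbols. The factors of \<open>M\<^sub>j\<close> have the form
  \<open>r \<cdot> X + (1 - r) \<cdot> F\<close>; let \<open>D\<^sub>j\<close> be the join of the \<open>F\<close> of the factors with \<open>r < 1\<close>, and
  let \<open>C\<close> be the convex hull of the monomials in which \<open>X\<close> does not occur. The smallest solution is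
  the convex hull of \<open>C\<close> and all joins of \<open>C\<close> with \<open>D\<^sub>j\<close>. It is a solution because the join is a
  semilattice operation on convex sets. It is contained in every solution \<open>Y\<close> because for
  \<open>d \<in> D\<^sub>j\<close> some contraction \<open>z \<mapsto> \<mu> \<cdot> z + (1 - \<mu>) \<cdot> d\<close> with \<open>0 \<le> \<mu> < 1\<close> maps \<open>Y\<close> into itself.
  Elimination uses only arithmetic on coefficients, and back substitution uses only the operations
  of the closure property, so that the procedure is an algorithm.\<close>

text \<open>Iterating the inequalities from the empty set need not stop. For
  \<open>X \<ge> {c} \<union> ((1/2) X + (1/2) {d})\<close> with c different from d, the half-open
  segment from c to d appears only in the limit. The closed formula takes the limit in one step. It
  is exact because a positive join omits the endpoint d: a contraction with positive factor towards
  d brings c arbitrarily close to d without reaching it.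

  If every monomial contains X with positive weight, then C is empty and so is the smallest
  solution, since all these monomials vanish at X = {}. The formula then has no terms, so empty sets
  and empty polynomials must be handled correctly throughout.

  Parameters need not be convex, but two laws require convexity: r A + s A = (r + s) A, which
  collects coefficients after a substitution, and idempotence of the join. Both become available
  because scaling, sums and joins commute with convex hulls, and unions do so up to one more hull.
  All sets may therefore be replaced by their hulls as long as only hulls of values are compared.
  The hulls of the parameters themselves are never computed.\<close>

section \<open>Positive joins\<close>

lemma scale_set_plus: "scale_set r (A + B) = scale_set r A + scale_set r B"
proof
  show "scale_set r A + scale_set r B \<subseteq> scale_set r (A + B)"
  proof
    fix x assume "x \<in> scale_set r A + scale_set r B"
    then obtain a b where "a \<in> A" "b \<in> B" "x = r *\<^sub>R (a + b)"
      by (auto elim!: set_plus_elim simp: scaleR_add_right)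
    then show "x \<in> scale_set r (A + B)" by blast
  qed
  show "scale_set r (A + B) \<subseteq> scale_set r A + scale_set r B"
    by (auto elim!: set_plus_elim simp: scaleR_add_right intro!: set_plus_intro)
qed

lemma pos_join_eq_Union: "pos_join A B = (\<Union>l\<in>{0<..<1}. scale_set l A + scale_set (1 - l) B)"
  unfolding pos_join_def set_plus_def by (fastforce simp: image_iff)

text \<open>The inclusion from right to left rests on convexity and fails for a two-point set. The
  law is what allows the coefficients of a symbol to be added when it occurs both in a substituted
  combination and next to the variable.\<close>

lemma convex_scale_add:
  assumes "convex A" "0 < r" "0 < s"
  shows "scale_set (r + s) A = scale_set r A + scale_set s A"
proof
  show "scale_set (r + s) A \<subseteq> scale_set r A + scale_set s A"
    by (auto simp: scaleR_add_left)
  show "scale_set r A + scale_set s A \<subseteq> scale_set (r + s) A"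
  proof
    fix x assume "x \<in> scale_set r A + scale_set s A"
    then obtain a b where ab: "a \<in> A" "b \<in> A" "x = r *\<^sub>R a + s *\<^sub>R b"
      by (auto elim!: set_plus_elim)
    have "(r / (r + s)) *\<^sub>R a + (s / (r + s)) *\<^sub>R b \<in> A"
      using assms ab by (intro convexD) (auto simp: add_divide_distrib[symmetric])
    moreover have "x = (r + s) *\<^sub>R ((r / (r + s)) *\<^sub>R a + (s / (r + s)) *\<^sub>R b)"
      using assms ab by (simp add: scaleR_add_right)
    ultimately show "x \<in> scale_set (r + s) A" by blast
  qed
qed

lemma convex_pos_join:
  assumes "convex A" "convex B"
  shows "convex (pos_join A B)"
proof (rule convexI)
  fix u v :: real
  fix p q :: 'a
  assume "p \<in> pos_join A B" "q \<in> pos_join A B" and uv: "0 \<le> u" "0 \<le> v" "u + v = 1"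
  then obtain l a b m c d where l: "0 < l" "l < 1" "0 < m" "m < 1"
    and abcd: "a \<in> A" "b \<in> B" "c \<in> A" "d \<in> B"
    and p: "p = l *\<^sub>R a + (1 - l) *\<^sub>R b" and q: "q = m *\<^sub>R c + (1 - m) *\<^sub>R d"
    unfolding pos_join_def by blast
  \<comment> \<open>\<open>k\<close> is the total weight of the points of \<open>A\<close> in the
    combination. Dividing the two \<open>A\<close>-weights by \<open>k\<close> and the two
    \<open>B\<close>-weights by \<open>1 - k\<close> regroups it as one point of \<open>A\<close>
    joined with one point of \<open>B\<close>.\<close>
  define k where "k = u * l + v * m"
  have v: "v = 1 - u" using uv by simp
  have k1: "1 - k = u * (1 - l) + v * (1 - m)"
    unfolding k_def v by (simp add: algebra_simps)
  have k: "0 < k" "0 < 1 - k"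
    using uv l unfolding k1 unfolding k_def
    by (cases "u = 0"; auto intro!: add_pos_nonneg)+
  have "(u * l / k) *\<^sub>R a + (v * m / k) *\<^sub>R c \<in> A"
    using assms(1) abcd uv l k
    by (intro convexD) (auto simp: add_divide_distrib[symmetric] k_def[symmetric])
  moreover have "(u * (1 - l) / (1 - k)) *\<^sub>R b + (v * (1 - m) / (1 - k)) *\<^sub>R d \<in> B"
    using assms(2) abcd uv l k
    by (intro convexD) (auto simp: add_divide_distrib[symmetric] k1[symmetric])
  ultimately have "k *\<^sub>R ((u * l / k) *\<^sub>R a + (v * m / k) *\<^sub>R c) +
      (1 - k) *\<^sub>R ((u * (1 - l) / (1 - k)) *\<^sub>R b + (v * (1 - m) / (1 - k)) *\<^sub>R d) \<in> pos_join A B"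
    using k by (intro pos_joinI) auto
  also have "k *\<^sub>R ((u * l / k) *\<^sub>R a + (v * m / k) *\<^sub>R c) +
      (1 - k) *\<^sub>R ((u * (1 - l) / (1 - k)) *\<^sub>R b + (v * (1 - m) / (1 - k)) *\<^sub>R d)
    = u *\<^sub>R p + v *\<^sub>R q"
    using k unfolding p q by (simp add: scaleR_add_right)
  finally show "u *\<^sub>R p + v *\<^sub>R q \<in> pos_join A B" .
qed

text \<open>At a fixed ratio \<open>l\<close> the join is a sum of scaled sets, and hulls commute
  with scaling and Minkowski sums. The other inclusion holds because the join of two convex sets is
  convex.\<close>

lemma convex_hull_pos_join:
  "convex hull (pos_join A B) = pos_join (convex hull A) (convex hull B)"
proof
  show "convex hull (pos_join A B) \<subseteq> pos_join (convex hull A) (convex hull B)"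
    by (intro hull_minimal pos_join_mono hull_subset convex_pos_join convex_convex_hull)
  have "scale_set l (convex hull A) + scale_set (1 - l) (convex hull B)
      \<subseteq> convex hull (pos_join A B)" if "l \<in> {0<..<1}" for l
  proof -
    have "scale_set l (convex hull A) + scale_set (1 - l) (convex hull B)
      = convex hull (scale_set l A + scale_set (1 - l) B)"
      by (simp add: convex_hull_set_plus convex_hull_scaling)
    also have "\<dots> \<subseteq> convex hull (pos_join A B)"
      using that unfolding pos_join_eq_Union by (intro hull_mono) blast
    finally show ?thesis .
  qed
  then show "pos_join (convex hull A) (convex hull B) \<subseteq> convex hull (pos_join A B)"
    unfolding pos_join_eq_Union[of "convex hull A"] by blast
qed

lemma subset_pos_join_self: "A \<subseteq> pos_join A A"
proof
  fix a assume "a \<in> A"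
  then have "(1/2) *\<^sub>R a + (1 - 1/2) *\<^sub>R a \<in> pos_join A A" by (intro pos_joinI) auto
  then show "a \<in> pos_join A A" by (simp flip: scaleR_add_left)
qed

lemma pos_join_convex_subset:
  assumes "convex X" "A \<subseteq> X" "B \<subseteq> X"
  shows "pos_join A B \<subseteq> X"
  using assms unfolding pos_join_def by (auto intro!: convexD)

lemma pos_join_idem: "convex A \<Longrightarrow> pos_join A A = A"
  by (simp add: pos_join_convex_subset subset_antisym subset_pos_join_self)

lemma pos_join_Union_left: "pos_join (\<Union>i\<in>I. A i) B = (\<Union>i\<in>I. pos_join (A i) B)"
  unfolding pos_join_def by blast

lemma pos_join_Union_right: "pos_join B (\<Union>i\<in>I. A i) = (\<Union>i\<in>I. pos_join B (A i))"
  unfolding pos_join_def by blast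

text \<open>The two sides of the join may use different points of \<open>T\<close>; convexity turns
  their average into a single point of \<open>T\<close>. This law distributes a factor
  \<open>r X + F\<close> over a join substituted for \<open>X\<close>.\<close>

lemma pos_join_affine:
  assumes "convex T"
  shows "pos_join (scale_set r A + T) (scale_set r B + T) = scale_set r (pos_join A B) + T"
proof
  show "scale_set r (pos_join A B) + T \<subseteq> pos_join (scale_set r A + T) (scale_set r B + T)"
  proof
    fix x assume "x \<in> scale_set r (pos_join A B) + T"
    then obtain l a b t where *: "x = r *\<^sub>R (l *\<^sub>R a + (1 - l) *\<^sub>R b) + t"
      "0 < l" "l < 1" "a \<in> A" "b \<in> B" "t \<in> T"
      unfolding pos_join_def by (auto elim!: set_plus_elim)
    have "l *\<^sub>R (r *\<^sub>R a + t) + (1 - l) *\<^sub>R (r *\<^sub>R b + t) \<in> pos_join (scale_set r A + T)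
      (scale_set r B + T)"
      using * by (intro pos_joinI) auto
    then show "x \<in> pos_join (scale_set r A + T) (scale_set r B + T)"
      unfolding * by (simp add: algebra_simps)
  qed
  show "pos_join (scale_set r A + T) (scale_set r B + T) \<subseteq> scale_set r (pos_join A B) + T"
  proof
    fix x assume "x \<in> pos_join (scale_set r A + T) (scale_set r B + T)"
    then obtain l a b t s where *: "x = l *\<^sub>R (r *\<^sub>R a + t) + (1 - l) *\<^sub>R (r *\<^sub>R b + s)"
      "0 < l" "l < 1" "a \<in> A" "b \<in> B" "t \<in> T" "s \<in> T"
      unfolding pos_join_def by (auto elim!: set_plus_elim)
    have "l *\<^sub>R t + (1 - l) *\<^sub>R s \<in> T"
      using * assms by (intro convexD) auto
    moreover have "r *\<^sub>R (l *\<^sub>R a + (1 - l) *\<^sub>R b) \<in> scale_set r (pos_join A B)"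
      using * by (intro imageI pos_joinI) auto
    moreover have "x = r *\<^sub>R (l *\<^sub>R a + (1 - l) *\<^sub>R b) + (l *\<^sub>R t + (1 - l) *\<^sub>R s)"
      unfolding * by (simp add: algebra_simps)
    ultimately show "x \<in> scale_set r (pos_join A B) + T" by blast
  qed
qed

lemma pos_joins_append:
  "As \<noteq> [] \<Longrightarrow> Bs \<noteq> [] \<Longrightarrow> pos_joins (As @ Bs) = pos_join (pos_joins As) (pos_joins Bs)"
  by (induction As rule: induct_list012) (simp_all add: pos_joins_Cons pos_join_assoc)

lemma convex_pos_joins: "(\<And>A. A \<in> set As \<Longrightarrow> convex A) \<Longrightarrow> convex (pos_joins As)"
  by (induction As rule: pos_joins.induct) (simp_all add: convex_pos_join)

lemma convex_hull_pos_joins: "convex hull (pos_joins As) = pos_joins (map ((hull) convex) As)"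
  by (induction As rule: pos_joins.induct) (simp_all add: convex_hull_pos_join)

lemma pos_joins_affine:
  "convex T \<Longrightarrow> As \<noteq> [] \<Longrightarrow>
   pos_joins (map (\<lambda>A. scale_set r A + T) As) = scale_set r (pos_joins As) + T"
  by (induction As rule: pos_joins.induct) (simp_all add: pos_join_affine)

lemma convex_hull_UN: "convex hull (\<Union>i\<in>I. A i) = convex hull (\<Union>i\<in>I. convex hull (A i))"
proof
  show "convex hull (\<Union>i\<in>I. A i) \<subseteq> convex hull (\<Union>i\<in>I. convex hull (A i))"
    by (intro hull_mono UN_mono hull_subset subset_refl)
  show "convex hull (\<Union>i\<in>I. convex hull (A i)) \<subseteq> convex hull (\<Union>i\<in>I. A i)"
    by (intro hull_minimal UN_least hull_mono convex_convex_hull) blast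
qed

section \<open>Polynomials as lists\<close>

text \<open>Convex combinations, monomials and polynomials are lists of coefficients, lists of factors and
  lists of monomials; the coefficient lists are aligned with the list of sets assigned to the
  symbols. Repetitions in these lists are harmless, since only convex hulls of the values matter and
  \<open>pos_join A A\<close> equals \<open>A\<close> for convex \<open>A\<close>.\<close>

definition positive_terms :: "real list \<Rightarrow> 'v list \<Rightarrow> (real \<times> 'v) list" where
  "positive_terms E Bs = filter (\<lambda>(r, B). 0 < r) (zip E Bs)"

definition comb_value :: "real list \<Rightarrow> 'v::real_vector set list \<Rightarrow> 'v set" where
  "comb_value E Bs = (\<Sum>(r, B)\<leftarrow>positive_terms E Bs. scale_set r B)"

definition mono_value :: "real list list \<Rightarrow> 'v::real_vector set list \<Rightarrow> 'v set" where
  "mono_value M Bs = pos_joins (map (\<lambda>E. comb_value E Bs) M)"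

definition monos_value :: "real list list list \<Rightarrow> 'v::real_vector set list \<Rightarrow> 'v set" where
  "monos_value \<phi> Bs = (\<Union>M\<in>set \<phi>. mono_value M Bs)"

definition is_comb :: "nat \<Rightarrow> real list \<Rightarrow> bool" where
  "is_comb k E \<longleftrightarrow> length E = k \<and> (\<forall>r\<in>set E. 0 \<le> r) \<and> sum_list E = 1"

definition is_mono :: "nat \<Rightarrow> real list list \<Rightarrow> bool" where
  "is_mono k M \<longleftrightarrow> M \<noteq> [] \<and> (\<forall>E\<in>set M. is_comb k E)"

text \<open>The join of the residue of \<open>M\<^sub>j\<close> is \<open>D\<^sub>j\<close>. The residue is the empty list if \<open>X\<close> is the only
  factor.\<close>

definition normalized_tl :: "real list \<Rightarrow> real list" where
  "normalized_tl E = map (\<lambda>r. r / (1 - hd E)) (tl E)"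

definition residue :: "real list list \<Rightarrow> real list list" where
  "residue M = map normalized_tl (filter (\<lambda>E. hd E \<noteq> 1) M)"

definition head_free :: "real list list \<Rightarrow> bool" where
  "head_free M \<longleftrightarrow> (\<forall>E\<in>set M. hd E = 0)"

text \<open>The set \<open>C\<close> itself comes from \<open>M = K\<close>, since a convex set joined with itself is unchanged.\<close>

definition eliminate :: "real list list list \<Rightarrow> real list list list" where
  "eliminate \<phi> = concat (map (\<lambda>K. map (\<lambda>M. residue K @ residue M) \<phi>) (filter head_free \<phi>))"

text \<open>The first branch matters when \<open>\<psi>\<close> is empty: a factor in which the
  variable has weight 0 must survive. The second branch then yields no monomial, as it should when
  the empty set enters with positive weight.\<close>

definition comb_subst :: "real list list list \<Rightarrow> real list \<Rightarrow> real list list list" where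
  "comb_subst \<psi> E = (if hd E = 0 then [[tl E]]
     else map (map (\<lambda>G. map2 (\<lambda>g e. hd E * g + e) G (tl E))) \<psi>)"

text \<open>\<open>[[]]\<close> is the neutral element for multiplying out formal products only. The
  join has no neutral set, and \<open>mono_value []\<close> is the junk value {}, so statements
  about values assume nonempty monomials.\<close>

fun mono_subst :: "real list list list \<Rightarrow> real list list \<Rightarrow> real list list list" where
  "mono_subst \<psi> [] = [[]]"
| "mono_subst \<psi> (E # M) =
     concat (map (\<lambda>N. map (\<lambda>N'. N @ N') (mono_subst \<psi> M)) (comb_subst \<psi> E))"

definition poly_subst :: "real list list list \<Rightarrow> real list list list \<Rightarrow> real list list list" where
  "poly_subst \<psi> \<phi> = concat (map (mono_subst \<psi>) \<phi>)"

text \<open>Heads of coefficient lists belong to the variable eliminated next. Substitution removes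
  them, so the remaining lists are aligned with the later variables followed by the
  parameters.\<close>

function solve :: "real list list list list \<Rightarrow> 'v::real_vector set list \<Rightarrow> 'v set list" where
  "solve [] Bs = []"
| "solve (\<phi> # sys) Bs =
     (let Xs = solve (map (poly_subst (eliminate \<phi>)) sys) Bs
      in (convex hull (monos_value (eliminate \<phi>) (Xs @ Bs))) # Xs)"
  by pat_completeness auto
termination by (relation "Wellfounded.measure (length \<circ> fst)") auto

definition solves :: "real list list list list \<Rightarrow> 'v::real_vector set list \<Rightarrow> 'v set list \<Rightarrow> bool"
  where
  "solves sys Bs Xs \<longleftrightarrow> (\<forall>X\<in>set Xs. convex X) \<and>
     list_all2 (\<lambda>\<phi> X. monos_value \<phi> (Xs @ Bs) \<subseteq> X) sys Xs"

section \<open>Monotonicity, convexity and hulls of the values\<close>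

lemma comb_value_simps [simp]:
  "comb_value [] Bs = {0}"
  "comb_value E [] = {0}"
  "comb_value (r # E) (B # Bs) = (if 0 < r then scale_set r B else {0}) + comb_value E Bs"
  by (auto simp: comb_value_def positive_terms_def)

lemma convex_comb_value: "(\<And>B. B \<in> set Bs \<Longrightarrow> convex B) \<Longrightarrow> convex (comb_value E Bs)"
  by (induction E Bs rule: list_induct2') (auto simp: convex_set_plus convex_scaling)

lemma convex_hull_comb_value:
  "convex hull (comb_value E Bs) = comb_value E (map ((hull) convex) Bs)"
  by (induction E Bs rule: list_induct2') (auto simp: convex_hull_set_plus convex_hull_scaling)

lemma comb_value_mono: "list_all2 (\<subseteq>) As Bs \<Longrightarrow> comb_value E As \<subseteq> comb_value E Bs"
proof (induction E arbitrary: As Bs)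
  case (Cons r E)
  show ?case
  proof (cases As)
    case (Cons A As')
    with Cons.prems obtain B Bs' where "Bs = B # Bs'" "A \<subseteq> B" "list_all2 (\<subseteq>) As' Bs'"
      by (auto simp: list_all2_Cons1)
    then show ?thesis using Cons Cons.IH[of As' Bs']
      by (simp add: set_plus_mono2 image_mono)
  qed (use Cons.prems in simp)
qed simp

lemma comb_value_map_scale:
  "0 < s \<Longrightarrow> comb_value (map (\<lambda>r. r * s) E) Bs = scale_set s (comb_value E Bs)"
  by (induction E Bs rule: list_induct2')
    (auto simp: scale_set_plus image_image zero_less_mult_iff mult.commute)

text \<open>Substitution into one factor, on the level of coefficients. Convexity of the sets
  matters only where a symbol has a positive coefficient in both lists.\<close>

lemma comb_value_add_scaled:
  assumes "0 < s" "length G = length E" "\<And>B. B \<in> set Bs \<Longrightarrow> convex B"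
    "\<And>g. g \<in> set G \<Longrightarrow> 0 \<le> g" "\<And>e. e \<in> set E \<Longrightarrow> 0 \<le> e"
  shows "comb_value (map2 (\<lambda>g e. s * g + e) G E) Bs
    = scale_set s (comb_value G Bs) + comb_value E Bs"
  using assms(2-)
proof (induction G E arbitrary: Bs rule: list_induct2)
  case (Cons g G e E)
  show ?case
  proof (cases Bs)
    case (Cons B Bs')
    have IH: "comb_value (map2 (\<lambda>g e. s * g + e) G E) Bs'
      = scale_set s (comb_value G Bs') + comb_value E Bs'"
      using Cons Cons.prems by (intro Cons.IH) auto
    consider "g = 0" "e = 0" | "g = 0" "0 < e" | "0 < g" "e = 0" | "0 < g" "0 < e"
      using Cons.prems(2)[of g] Cons.prems(3)[of e] by force
    then show ?thesis
    proof cases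
      case 4
      then have "scale_set (s * g + e) B = scale_set s (scale_set g B) + scale_set e B"
        using Cons Cons.prems \<open>0 < s\<close> by (simp add: convex_scale_add image_image)
      moreover have "0 < s * g + e" using 4 \<open>0 < s\<close> by (simp add: add_pos_pos)
      ultimately show ?thesis using 4 Cons IH by (simp add: scale_set_plus ac_simps)
    qed (use Cons IH \<open>0 < s\<close> in \<open>simp_all add: scale_set_plus ac_simps image_image\<close>)
  qed simp
qed simp

lemma mono_value_mono: "list_all2 (\<subseteq>) As Bs \<Longrightarrow> mono_value M As \<subseteq> mono_value M Bs"
  unfolding mono_value_def
  by (intro pos_joins_mono) (simp add: list_all2_map1 list_all2_map2 list.rel_refl comb_value_mono)

lemma monos_value_mono: "list_all2 (\<subseteq>) As Bs \<Longrightarrow> monos_value \<phi> As \<subseteq> monos_value \<phi> Bs"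
  unfolding monos_value_def by (intro UN_mono mono_value_mono) auto

lemma convex_mono_value: "(\<And>B. B \<in> set Bs \<Longrightarrow> convex B) \<Longrightarrow> convex (mono_value M Bs)"
  unfolding mono_value_def by (intro convex_pos_joins) (auto intro: convex_comb_value)

lemma convex_hull_mono_value:
  "convex hull (mono_value M Bs) = mono_value M (map ((hull) convex) Bs)"
  by (simp add: mono_value_def convex_hull_pos_joins convex_hull_comb_value o_def)

text \<open>This is the reduction to convex parameters, on which coefficients may be collected and
  joins are idempotent.\<close>

lemma convex_hull_monos_value:
  "convex hull (monos_value \<phi> Bs) = convex hull (monos_value \<phi> (map ((hull) convex) Bs))"
  unfolding monos_value_def
  by (subst convex_hull_UN) (simp add: convex_hull_mono_value)

lemma mono_value_append:
  "M \<noteq> [] \<Longrightarrow> N \<noteq> [] \<Longrightarrow> mono_value (M @ N) Bs = pos_join (mono_value M Bs) (mono_value N Bs)"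
  by (simp add: mono_value_def pos_joins_append)

lemma mono_value_Cons:
  "M \<noteq> [] \<Longrightarrow> mono_value (E # M) Bs = pos_join (comb_value E Bs) (mono_value M Bs)"
  by (simp add: mono_value_def pos_joins_Cons)

lemma mono_value_single: "mono_value [E] Bs = comb_value E Bs"
  by (simp add: mono_value_def)

lemma monos_value_products:
  assumes "\<And>N. N \<in> set \<phi> \<Longrightarrow> N \<noteq> []" "\<And>N. N \<in> set \<psi> \<Longrightarrow> N \<noteq> []"
  shows "monos_value (concat (map (\<lambda>N. map (\<lambda>N'. N @ N') \<psi>) \<phi>)) Bs
    = pos_join (monos_value \<phi> Bs) (monos_value \<psi> Bs)"
  using assms unfolding monos_value_def pos_join_Union_left pos_join_Union_right
  by (auto simp: mono_value_append)

lemma UN_set_plus: "(\<Union>i\<in>I. A i) + B = (\<Union>i\<in>I. A i + B)"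
  unfolding set_plus_def by blast

section \<open>Substitution\<close>

lemma is_comb_Cons:
  assumes "is_comb (Suc k) E"
  obtains r F where "E = r # F" "0 \<le> r" "r \<le> 1" "length F = k" "\<forall>e\<in>set F. 0 \<le> e"
    "sum_list F = 1 - r"
proof -
  obtain r F where E: "E = r # F" using assms by (cases E) (auto simp: is_comb_def)
  have "0 \<le> sum_list F" using assms E by (intro sum_list_nonneg) (simp add: is_comb_def)
  then show ?thesis using assms E that[of r F] by (simp add: is_comb_def)
qed

lemma comb_subst_nonempty:
  "(\<And>N. N \<in> set \<psi> \<Longrightarrow> is_mono k N) \<Longrightarrow> N \<in> set (comb_subst \<psi> E) \<Longrightarrow> N \<noteq> []"
  by (auto simp: comb_subst_def is_mono_def split: if_splits)

lemma mono_subst_nonempty: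
  assumes "\<And>N. N \<in> set \<psi> \<Longrightarrow> is_mono k N" "M \<noteq> []" "N \<in> set (mono_subst \<psi> M)"
  shows "N \<noteq> []"
proof -
  obtain E M' where "M = E # M'" using assms(2) by (cases M) auto
  then obtain N1 N2 where "N1 \<in> set (comb_subst \<psi> E)" "N = N1 @ N2" using assms(3) by auto
  then show ?thesis using comb_subst_nonempty[OF assms(1)] by blast
qed

lemma sum_list_add_scaled:
  "length G = length E \<Longrightarrow>
   sum_list (map2 (\<lambda>g e. s * g + e) G E) = s * sum_list G + (sum_list E :: real)"
  by (induction G E rule: list_induct2) (simp_all add: algebra_simps)

lemma is_mono_comb_subst:
  assumes "\<And>N. N \<in> set \<psi> \<Longrightarrow> is_mono k N" "is_comb (Suc k) E" "N \<in> set (comb_subst \<psi> E)"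
  shows "is_mono k N"
proof -
  obtain r F where E: "E = r # F" "0 \<le> r" "r \<le> 1" "length F = k" "\<forall>e\<in>set F. 0 \<le> e"
    "sum_list F = 1 - r"
    using is_comb_Cons[OF assms(2)] .
  show ?thesis
  proof (cases "r = 0")
    case True
    then show ?thesis using E assms by (simp add: comb_subst_def is_mono_def is_comb_def)
  next
    case False
    then obtain N' where N': "N' \<in> set \<psi>" "N = map (\<lambda>G. map2 (\<lambda>g e. r * g + e) G F) N'"
      using assms E by (auto simp: comb_subst_def)
    have "is_comb k (map2 (\<lambda>g e. r * g + e) G F)" if "G \<in> set N'" for G
    proof -
      have "is_comb k G" using assms N' that by (auto simp: is_mono_def)
      moreover from this have "0 \<le> r * g + e" if "(g, e) \<in> set (zip G F)" for g e
        using E set_zip_leftD[OF that] set_zip_rightD[OF that] by (simp add: is_comb_def)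
      ultimately show ?thesis using E by (auto simp: is_comb_def sum_list_add_scaled)
    qed
    then show ?thesis using N' assms(1)[of N'] by (auto simp: is_mono_def)
  qed
qed

lemma is_mono_mono_subst:
  assumes "\<And>N. N \<in> set \<psi> \<Longrightarrow> is_mono k N" "is_mono (Suc k) M" "N \<in> set (mono_subst \<psi> M)"
  shows "is_mono k N"
proof -
  have "\<forall>E\<in>set N. is_comb k E" using assms(2,3)
  proof (induction M arbitrary: N)
    case (Cons E M)
    from Cons.prems(2) obtain N1 N2 where N: "N = N1 @ N2" "N1 \<in> set (comb_subst \<psi> E)"
      "N2 \<in> set (mono_subst \<psi> M)"
      by auto
    have "is_comb (Suc k) E" using Cons.prems(1) by (simp add: is_mono_def)
    then have "is_mono k N1" using is_mono_comb_subst[OF assms(1) _ N(2)] by blast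
    moreover have "\<forall>E\<in>set N2. is_comb k E"
    proof (cases "M = []")
      case False
      then have "is_mono (Suc k) M" using Cons.prems(1) by (simp add: is_mono_def)
      then show ?thesis using N(3) by (rule Cons.IH)
    qed (use N in simp)
    ultimately show ?case using N(1) by (auto simp: is_mono_def)
  qed simp
  moreover have "N \<noteq> []"
    using mono_subst_nonempty[OF assms(1) _ assms(3)] assms(2) by (simp add: is_mono_def)
  ultimately show ?thesis by (simp add: is_mono_def)
qed

lemma is_mono_poly_subst:
  assumes "\<And>N. N \<in> set \<psi> \<Longrightarrow> is_mono k N" "\<And>M. M \<in> set \<phi> \<Longrightarrow> is_mono (Suc k) M"
    "N \<in> set (poly_subst \<psi> \<phi>)"
  shows "is_mono k N"
  using assms is_mono_mono_subst unfolding poly_subst_def by fastforce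

text \<open>The map taking \<open>Y\<close> to \<open>r Y + F\<close> distributes over joins because
  \<open>F\<close> is convex; it also distributes over unions and commutes with hulls.\<close>

lemma convex_hull_comb_subst:
  assumes \<psi>: "\<And>N. N \<in> set \<psi> \<Longrightarrow> is_mono k N" and E: "is_comb (Suc k) E"
    and convex: "\<And>B. B \<in> set Bs \<Longrightarrow> convex B"
  shows "convex hull (monos_value (comb_subst \<psi> E) Bs)
    = comb_value E ((convex hull (monos_value \<psi> Bs)) # Bs)"
proof -
  obtain r F where rF: "E = r # F" "0 \<le> r" "length F = k" "\<forall>e\<in>set F. 0 \<le> e"
    using is_comb_Cons[OF E] by metis
  have F: "convex (comb_value F Bs)" using convex by (rule convex_comb_value)
  then have hull_F: "convex hull (comb_value F Bs) = comb_value F Bs" by (simp only: convex_hull_eq)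
  show ?thesis
  proof (cases "r = 0")
    case True
    then show ?thesis using rF
      by (simp add: comb_subst_def monos_value_def mono_value_single hull_F)
  next
    case False
    then have r: "0 < r" using rF by simp
    have "mono_value (map (\<lambda>G. map2 (\<lambda>g e. r * g + e) G F) N) Bs
      = scale_set r (mono_value N Bs) + comb_value F Bs" if N: "N \<in> set \<psi>" for N
    proof -
      have "comb_value (map2 (\<lambda>g e. r * g + e) G F) Bs
        = scale_set r (comb_value G Bs) + comb_value F Bs"
        if "G \<in> set N" for G
        using \<psi>[OF N] that rF
          by (intro comb_value_add_scaled r convex) (auto simp: is_mono_def is_comb_def)
      then have "mono_value (map (\<lambda>G. map2 (\<lambda>g e. r * g + e) G F) N) Bs
        = pos_joins (map (\<lambda>A. scale_set r A + comb_value F Bs) (map (\<lambda>G. comb_value G Bs) N))"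
        by (auto simp: mono_value_def o_def intro!: arg_cong[of _ _ pos_joins])
      also have "\<dots> = scale_set r (mono_value N Bs) + comb_value F Bs"
        using \<psi>[OF N] by (subst pos_joins_affine[OF F]) (auto simp: mono_value_def is_mono_def)
      finally show ?thesis .
    qed
    then have "monos_value (comb_subst \<psi> E) Bs
      = (\<Union>N\<in>set \<psi>. scale_set r (mono_value N Bs) + comb_value F Bs)"
      using r rF(1) by (simp add: comb_subst_def monos_value_def)
    also have "\<dots> = scale_set r (monos_value \<psi> Bs) + comb_value F Bs"
      by (simp only: monos_value_def image_UN UN_set_plus)
    finally have "monos_value (comb_subst \<psi> E) Bs
      = scale_set r (monos_value \<psi> Bs) + comb_value F Bs" .
    then show ?thesis using r rF(1)
      by (simp add: convex_hull_set_plus convex_hull_scaling hull_F)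
  qed
qed

lemma convex_hull_mono_subst:
  assumes \<psi>: "\<And>N. N \<in> set \<psi> \<Longrightarrow> is_mono k N" and M: "is_mono (Suc k) M"
    and convex: "\<And>B. B \<in> set Bs \<Longrightarrow> convex B"
  shows "convex hull (monos_value (mono_subst \<psi> M) Bs)
    = mono_value M ((convex hull (monos_value \<psi> Bs)) # Bs)"
proof -
  have "M \<noteq> []" using M by (simp add: is_mono_def)
  then show ?thesis using M
  proof (induction M rule: list_nonempty_induct)
    case (single E)
    then have "is_comb (Suc k) E" by (simp add: is_mono_def)
    moreover have "mono_subst \<psi> [E] = comb_subst \<psi> E"
      by (simp add: concat_map_singleton)
    ultimately show ?case using convex_hull_comb_subst[OF \<psi> _ convex]
      by (simp add: mono_value_single)
  next
    case (cons E M)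
    then have *: "is_comb (Suc k) E" "is_mono (Suc k) M" by (simp_all add: is_mono_def)
    have "monos_value (mono_subst \<psi> (E # M)) Bs
      = pos_join (monos_value (comb_subst \<psi> E) Bs) (monos_value (mono_subst \<psi> M) Bs)"
      using comb_subst_nonempty[OF \<psi>] mono_subst_nonempty[OF \<psi> \<open>M \<noteq> []\<close>]
      by (simp add: monos_value_products)
    then show ?case
      using cons.IH[OF *(2)] convex_hull_comb_subst[OF \<psi> *(1) convex] cons.hyps
      by (simp add: convex_hull_pos_join mono_value_Cons)
  qed
qed

text \<open>The lemmas for single factors and monomials need convex sets. The computation is
  therefore done for the hulls of \<open>Bs\<close>, which are then removed from both sides.\<close>

lemma convex_hull_poly_subst:
  assumes \<psi>: "\<And>N. N \<in> set \<psi> \<Longrightarrow> is_mono k N" and \<phi>: "\<And>M. M \<in> set \<phi> \<Longrightarrow> is_mono (Suc k) M"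
  shows "convex hull (monos_value (poly_subst \<psi> \<phi>) Bs)
    = convex hull (monos_value \<phi> ((convex hull (monos_value \<psi> Bs)) # Bs))"
proof -
  let ?Cs = "map (\<lambda>B. convex hull B) Bs"
  let ?Q = "convex hull (monos_value \<psi> ?Cs)"
  have "convex hull (monos_value (poly_subst \<psi> \<phi>) ?Cs)
    = convex hull (\<Union>M\<in>set \<phi>. convex hull (monos_value (mono_subst \<psi> M) ?Cs))"
    by (subst convex_hull_UN[symmetric]) (simp add: poly_subst_def monos_value_def)
  also have "\<dots> = convex hull (monos_value \<phi> (?Q # ?Cs))"
  proof -
    have "convex hull (monos_value (mono_subst \<psi> M) ?Cs) = mono_value M (?Q # ?Cs)" if "M \<in> set \<phi>"
      for M
      using \<psi> \<phi>[OF that] by (rule convex_hull_mono_subst) auto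
    then show ?thesis unfolding monos_value_def[of \<phi>] by simp
  qed
  \<comment> \<open>The inserted set is already a hull, so taking hulls of the whole list leaves it
    unchanged.\<close>
  also have "\<dots>
    = convex hull (monos_value \<phi> (map (\<lambda>B. convex hull B) ((convex hull (monos_value \<psi> Bs)) # Bs)))"
    unfolding list.map hull_hull convex_hull_monos_value[of \<psi> Bs, symmetric] ..
  finally show ?thesis
    by (rule trans[OF trans[OF convex_hull_monos_value] convex_hull_monos_value[symmetric]])
qed

section \<open>Elimination of one variable\<close>

lemma normalized_tl_zero [simp]: "normalized_tl (0 # F) = F"
  by (simp add: normalized_tl_def)

lemma is_comb_normalized_tl:
  assumes "is_comb (Suc k) E" "hd E \<noteq> 1"
  shows "is_comb k (normalized_tl E)"
proof -
  obtain r F where E: "E = r # F" "0 \<le> r" "r \<le> 1" "length F = k" "\<forall>e\<in>set F. 0 \<le> e"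
    "sum_list F = 1 - r"
    using is_comb_Cons[OF assms(1)] .
  have "sum_list (map (\<lambda>e. e / (1 - r)) F) = sum_list F / (1 - r)"
    by (induction F) (simp_all add: add_divide_distrib)
  then show ?thesis using E assms by (auto simp: is_comb_def normalized_tl_def)
qed

lemma comb_value_zero: "(\<And>e. e \<in> set F \<Longrightarrow> e = 0) \<Longrightarrow> comb_value F Bs = {0}"
  by (induction F Bs rule: list_induct2') force+

lemma comb_value_hd_one:
  assumes "is_comb (Suc k) E" "hd E = 1"
  shows "comb_value E (X # Bs) = X"
proof -
  obtain r F where E: "E = r # F" "length F = k" "\<forall>e\<in>set F. 0 \<le> e" "sum_list F = 1 - r"
    using is_comb_Cons[OF assms(1)] by metis
  have "sum_list F = 0" using E assms by simp
  then have "e = 0" if "e \<in> set F" for e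
    using that E by (simp add: sum_list_nonneg_eq_0_iff)
  then have F: "comb_value F Bs = {0}" by (rule comb_value_zero)
  have "r = 1" using E(1) assms(2) by simp
  then show ?thesis unfolding E(1) by (simp add: F)
qed

lemma comb_value_hd_zero:
  assumes "is_comb (Suc k) E" "hd E = 0"
  shows "comb_value E (X # Bs) = comb_value (normalized_tl E) Bs"
proof -
  obtain F where "E = 0 # F" using is_comb_Cons[OF assms(1)] assms(2) by (metis list.sel(1))
  then show ?thesis by simp
qed

lemma comb_value_hd_pos:
  assumes "is_comb (Suc k) E" "0 < hd E" "hd E \<noteq> 1"
  shows "comb_value E (X # Bs)
    = scale_set (hd E) X + scale_set (1 - hd E) (comb_value (normalized_tl E) Bs)"
proof -
  obtain r F where E: "E = r # F" "0 \<le> r" "r \<le> 1"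
    using is_comb_Cons[OF assms(1)] by metis
  then have "r < 1" using assms by simp
  moreover from this have "comb_value F Bs
    = comb_value (map (\<lambda>s. s * (1 - r)) (map (\<lambda>e. e / (1 - r)) F)) Bs"
    by (simp add: o_def)
  ultimately have "comb_value F Bs = scale_set (1 - r) (comb_value (normalized_tl E) Bs)"
    using E by (simp only: comb_value_map_scale) (simp add: normalized_tl_def comb_value_map_scale)
  then show ?thesis using E assms by simp
qed

lemma residue_Cons:
  "residue (E # M) = (if hd E = 1 then residue M else normalized_tl E # residue M)"
  by (simp add: residue_def)

lemma residue_Nil [simp]: "residue [] = []"
  by (simp add: residue_def)

lemma residue_append: "residue (M @ N) = residue M @ residue N"
  by (simp add: residue_def)

lemma is_mono_eliminate:
  assumes "\<And>M. M \<in> set \<phi> \<Longrightarrow> is_mono (Suc k) M" "N \<in> set (eliminate \<phi>)"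
  shows "is_mono k N"
proof -
  obtain K M where *: "K \<in> set \<phi>" "M \<in> set \<phi>" "head_free K" "N = residue K @ residue M"
    using assms(2) by (auto simp: eliminate_def)
  have "is_comb k E" if "E \<in> set N" for E
  proof -
    from that * consider "E \<in> set (residue K)" | "E \<in> set (residue M)" by auto
    then obtain E' M' where "E' \<in> set M'" "M' \<in> set \<phi>" "hd E' \<noteq> 1" "E = normalized_tl E'"
      using * by cases (auto simp: residue_def)
    then show ?thesis using assms(1) is_comb_normalized_tl by (auto simp: is_mono_def)
  qed
  \<comment> \<open>All heads of \<open>K\<close> are 0, hence none equals 1 and no factor is
    dropped. \<open>residue M\<close> may well be empty.\<close>
  moreover have "residue K \<noteq> []"
    using assms(1)[OF *(1)] * by (cases K) (auto simp: residue_Cons head_free_def is_mono_def)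
  ultimately show ?thesis using * by (simp add: is_mono_def)
qed

lemma mono_value_head_free:
  assumes "is_mono (Suc k) M" "head_free M"
  shows "mono_value M (X # Bs) = mono_value (residue M) Bs" "residue M \<noteq> []"
proof -
  have 1: "residue M = map normalized_tl M"
    unfolding residue_def using assms by (subst filter_True) (auto simp: head_free_def)
  then show "residue M \<noteq> []" using assms by (simp add: is_mono_def)
  show "mono_value M (X # Bs) = mono_value (residue M) Bs"
    unfolding mono_value_def 1 map_map o_def using assms
    by (intro arg_cong[of _ _ pos_joins] map_cong comb_value_hd_zero refl)
      (auto simp: is_mono_def head_free_def)
qed

lemma pos_joins_swap: "pos_joins (A # B # As) = pos_joins (B # A # As)"
  by (rule pos_joins_mset) simp

lemma pos_joins_absorb: "convex X \<Longrightarrow> pos_join X (pos_joins (X # As)) = pos_joins (X # As)"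
  by (cases As) (simp_all add: pos_join_idem flip: pos_join_assoc)

lemma scale_plus_subset_pos_join:
  "0 < r \<Longrightarrow> r < 1 \<Longrightarrow> scale_set r A + scale_set (1 - r) B \<subseteq> pos_join A B"
  unfolding pos_join_eq_Union by auto

text \<open>A factor \<open>r X + (1 - r) F\<close> with \<open>0 < r < 1\<close> lies in the join
  of \<open>X\<close> and \<open>F\<close>. The extra leading \<open>X\<close> absorbs the copy of
  \<open>X\<close> released in this way, because the convex set \<open>X\<close> is
  idempotent.\<close>

lemma pos_joins_residue:
  assumes "convex X" "\<And>E. E \<in> set M \<Longrightarrow> is_comb (Suc k) E"
  shows "pos_joins (X # map (\<lambda>E. comb_value E (X # Bs)) M)
    \<subseteq> pos_joins (X # map (\<lambda>E. comb_value E Bs) (residue M))"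
  using assms(2)
proof (induction M)
  case (Cons E M)
  let ?L = "map (\<lambda>E. comb_value E (X # Bs)) M" and ?R = "map (\<lambda>E. comb_value E Bs) (residue M)"
  have E: "is_comb (Suc k) E" using Cons by simp
  have r: "0 \<le> hd E" "hd E \<le> 1" using is_comb_Cons[OF E] by (metis list.sel(1))+
  have "pos_joins (X # comb_value E (X # Bs) # ?L)
    = pos_join (comb_value E (X # Bs)) (pos_joins (X # ?L))"
    by (simp only: pos_joins_swap[of X]) simp
  also have "\<dots> \<subseteq> pos_join (comb_value E (X # Bs)) (pos_joins (X # ?R))"
    using Cons by (intro pos_join_mono) auto
  also have "\<dots> \<subseteq> pos_joins (X # map (\<lambda>E. comb_value E Bs) (residue (E # M)))"
  proof -
    consider "hd E = 1" | "hd E = 0" | "0 < hd E" "hd E < 1" using r by linarith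
    then show ?thesis
    proof cases
      case 1
      then show ?thesis using comb_value_hd_one[OF E 1, of X Bs] assms
        by (simp add: residue_Cons pos_joins_absorb)
    next
      case 2
      then show ?thesis using comb_value_hd_zero[OF E 2, of X Bs] assms
        by (simp add: residue_Cons pos_joins_swap[of X] del: pos_joins.simps(3)) simp
    next
      case 3
      let ?F = "comb_value (normalized_tl E) Bs"
      have "comb_value E (X # Bs) \<subseteq> pos_join X ?F"
        using comb_value_hd_pos[OF E 3(1), of X Bs] 3 scale_plus_subset_pos_join[OF 3, of X ?F]
          by simp
      then have "pos_join (comb_value E (X # Bs)) (pos_joins (X # ?R))
        \<subseteq> pos_join (pos_join X ?F) (pos_joins (X # ?R))"
        by (intro pos_join_mono) auto
      also have "\<dots> = pos_join ?F (pos_joins (X # ?R))"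
        using pos_joins_absorb[OF assms(1), of ?R] by (metis pos_join_assoc pos_join_commute)
      also have "\<dots> = pos_joins (X # ?F # ?R)"
        by (simp only: pos_joins_swap[of X]) simp
      finally show ?thesis using 3 by (simp add: residue_Cons)
    qed
  qed
  finally show ?case by simp
qed simp

text \<open>A factor in which the variable has positive weight supplies the leading \<open>X\<close>
  that \<open>pos_joins_residue\<close> presupposes; the remaining factors are then treated by that
  lemma.\<close>

lemma mono_value_residue:
  assumes X: "convex X" and M: "is_mono (Suc k) M" "\<not> head_free M"
  shows "mono_value M (X # Bs) \<subseteq> pos_joins (X # map (\<lambda>E. comb_value E Bs) (residue M))"
proof -
  have comb: "\<And>E. E \<in> set M \<Longrightarrow> is_comb (Suc k) E" using M by (simp add: is_mono_def)
  obtain E where E: "E \<in> set M" "hd E \<noteq> 0" using M(2) by (auto simp: head_free_def)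
  obtain M1 M2 where M12: "M = M1 @ E # M2" using split_list[OF E(1)] by blast
  have r: "0 < hd E" "hd E \<le> 1" using is_comb_Cons[OF comb[OF E(1)]] E(2)
    by (metis list.sel(1) order_less_le)+
  let ?v = "\<lambda>E. comb_value E (X # Bs)" and ?w = "\<lambda>E. comb_value E Bs"
  have "mono_value M (X # Bs) = pos_joins (?v E # map ?v (M1 @ M2))"
    unfolding mono_value_def M12 by (rule pos_joins_mset) simp
  also have "\<dots> \<subseteq> pos_joins (X # map ?w (residue (E # M1 @ M2)))"
  proof (cases "hd E = 1")
    case True
    then show ?thesis
      using pos_joins_residue[OF X, of "M1 @ M2" k Bs] comb
        comb_value_hd_one[OF comb[OF E(1)] True, of X Bs] M12
      by (simp add: residue_Cons)
  next
    case False
    let ?F = "?w (normalized_tl E)"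
    have "?v E \<subseteq> pos_join X ?F"
      using comb_value_hd_pos[OF comb[OF E(1)] r(1) False, of X Bs] scale_plus_subset_pos_join[of
        "hd E" X ?F] r False by simp
    then have "pos_joins (?v E # map ?v (M1 @ M2)) \<subseteq> pos_joins (pos_join X ?F # map ?v (M1 @ M2))"
      by (intro pos_joins_mono) (simp add: list.rel_refl)
    also have "\<dots> = pos_join ?F (pos_joins (X # map ?v (M1 @ M2)))"
      by (cases "map ?v (M1 @ M2) = []") (simp_all only: pos_joins_Cons pos_join_commute[of X ?F]
        pos_join_assoc pos_joins.simps not_False_eq_True)
    also have "\<dots> \<subseteq> pos_join ?F (pos_joins (X # map ?w (residue (M1 @ M2))))"
      using comb M12 by (intro pos_join_mono pos_joins_residue[OF X, of _ k]) auto
    also have "\<dots> = pos_joins (X # ?F # map ?w (residue (M1 @ M2)))"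
      by (simp only: pos_joins_swap[of X]) simp
    finally show ?thesis using False by (simp add: residue_Cons)
  qed
  also have "\<dots> = pos_joins (X # map ?w (residue M))"
    unfolding M12 by (rule pos_joins_mset) (simp add: residue_Cons residue_append)
  finally show ?thesis .
qed

section \<open>The eliminated formula satisfies the inequality\<close>

lemma monos_value_eliminate:
  "monos_value (eliminate \<phi>) Bs
    = (\<Union>K\<in>{K\<in>set \<phi>. head_free K}. \<Union>M\<in>set \<phi>. mono_value (residue K @ residue M) Bs)"
  by (auto simp: monos_value_def eliminate_def)

lemma eliminate_solves_convex:
  assumes \<phi>: "\<And>M. M \<in> set \<phi> \<Longrightarrow> is_mono (Suc k) M" and Bs: "\<And>B. B \<in> set Bs \<Longrightarrow> convex B"
  shows "monos_value \<phi> ((convex hull (monos_value (eliminate \<phi>) Bs)) # Bs)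
    \<subseteq> convex hull (monos_value (eliminate \<phi>) Bs)"
proof -
  define S where "S = monos_value (eliminate \<phi>) Bs"
  define X where "X = convex hull S"
  have X: "convex X" "S \<subseteq> X" by (simp_all add: X_def hull_subset)
  have S: "mono_value (residue K @ residue M) Bs \<subseteq> S" if "K \<in> set \<phi>" "head_free K" "M \<in> set \<phi>"
    for K M
    using that unfolding S_def monos_value_eliminate by blast
  have conv: "convex (mono_value N Bs)" for N using Bs by (rule convex_mono_value)
  \<comment> \<open>It suffices to join the generators in \<open>S\<close> with the residue, since
    the hull of a join is the join of the hulls and the residue is convex.\<close>
  have absorb: "pos_join X (mono_value (residue M) Bs) \<subseteq> X" if M: "M \<in> set \<phi>" "residue M \<noteq> []" for M
  proof -
    let ?d = "mono_value (residue M) Bs"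
    have "pos_join (mono_value (residue K @ residue N) Bs) ?d \<subseteq> X"
      if KN: "K \<in> set \<phi>" "head_free K" "N \<in> set \<phi>" for K N
    proof -
      let ?k = "mono_value (residue K) Bs"
      have K: "residue K \<noteq> []" using mono_value_head_free(2)[OF \<phi>[OF KN(1)] KN(2)] .
      have kd: "pos_join ?k ?d \<subseteq> X"
        using S[OF KN(1,2) M(1)] K M X by (simp add: mono_value_append)
      show ?thesis
      proof (cases "residue N = []")
        case True
        then show ?thesis using kd by simp
      next
        case False
        let ?n = "mono_value (residue N) Bs"
        have kn: "pos_join ?k ?n \<subseteq> X" using S[OF KN] K False X by (simp add: mono_value_append)
        \<comment> \<open>Duplicating \<open>?k\<close> splits the triple join into the joins of
          \<open>?k\<close> with \<open>?n\<close> and of \<open>?k\<close> with \<open>?d\<close>.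
          Both lie in the convex set \<open>X\<close>, which is why \<open>eliminate\<close> need
          not list joins with several residues at once.\<close>
        have "pos_join (pos_join ?k ?n) ?d = pos_join (pos_join (pos_join ?k ?k) ?n) ?d"
          by (simp add: pos_join_idem conv)
        also have "\<dots> = pos_join (pos_join ?k ?n) (pos_join ?k ?d)"
          by (metis pos_join_assoc pos_join_commute)
        also have "\<dots> \<subseteq> X" using X(1) kn kd by (rule pos_join_convex_subset)
        finally show ?thesis using K False by (simp add: mono_value_append)
      qed
    qed
    then have "pos_join S ?d \<subseteq> X"
      unfolding S_def monos_value_eliminate pos_join_Union_left by blast
    then have "convex hull (pos_join S ?d) \<subseteq> X" using X by (simp add: hull_minimal)
    then show ?thesis by (simp add: convex_hull_pos_join X_def hull_same[of convex ?d, OF conv])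
  qed
  have "mono_value M (X # Bs) \<subseteq> X" if M: "M \<in> set \<phi>" for M
  proof (cases "head_free M")
    case True
    have "mono_value M (X # Bs) \<subseteq> pos_join (mono_value (residue M) Bs) (mono_value (residue M) Bs)"
      unfolding mono_value_head_free(1)[OF \<phi>[OF M] True] by (rule subset_pos_join_self)
    also have "\<dots> \<subseteq> S"
      using S[OF M True M] mono_value_head_free(2)[OF \<phi>[OF M] True] by (simp add: mono_value_append)
    finally show ?thesis using X by blast
  next
    case False
    then have "mono_value M (X # Bs) \<subseteq> pos_joins (X # map (\<lambda>E. comb_value E Bs) (residue M))"
      by (intro mono_value_residue[OF X(1) \<phi>[OF M]])
    also have "\<dots> \<subseteq> X"
      using absorb[OF M] by (cases "residue M = []") (simp_all add: pos_joins_Cons mono_value_def)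
    finally show ?thesis .
  qed
  then show ?thesis unfolding X_def S_def monos_value_def[of \<phi>] by blast
qed

lemma eliminate_solves:
  assumes \<phi>: "\<And>M. M \<in> set \<phi> \<Longrightarrow> is_mono (Suc k) M"
  shows "monos_value \<phi> ((convex hull (monos_value (eliminate \<phi>) Bs)) # Bs)
    \<subseteq> convex hull (monos_value (eliminate \<phi>) Bs)"
proof -
  let ?Cs = "map (\<lambda>B. convex hull B) Bs"
  let ?X = "convex hull (monos_value (eliminate \<phi>) Bs)"
  have X: "?X = convex hull (monos_value (eliminate \<phi>) ?Cs)" by (rule convex_hull_monos_value)
  have "monos_value \<phi> (?X # Bs) \<subseteq> monos_value \<phi> (?X # ?Cs)"
    by (rule monos_value_mono) (simp add: list.rel_map list.rel_refl hull_subset)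
  also have "\<dots> \<subseteq> ?X" unfolding X using \<phi> by (rule eliminate_solves_convex) auto
  finally show ?thesis .
qed

section \<open>Minimality through contractions\<close>

lemma pure_mono_value:
  assumes "is_mono (Suc k) M" "residue M = []"
  shows "Y \<subseteq> mono_value M (Y # Bs)"
proof -
  have "M \<noteq> []" using assms by (simp add: is_mono_def)
  then show ?thesis using assms
  proof (induction M rule: list_nonempty_induct)
    case (single E)
    then show ?case using comb_value_hd_one[of k E Y Bs]
      by (auto simp: mono_value_single residue_Cons is_mono_def split: if_splits)
  next
    case (cons E M)
    then have "comb_value E (Y # Bs) = Y" "Y \<subseteq> mono_value M (Y # Bs)"
      using comb_value_hd_one[of k E Y Bs] by (auto simp: residue_Cons is_mono_def split: if_splits)
    \<comment> \<open>Every factor is the variable itself, so the value is an iterated join of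
      \<open>Y\<close>. Every set lies in its join with itself, so \<open>Y\<close> need not be
      convex here.\<close>
    then have "pos_join Y Y \<subseteq> mono_value (E # M) (Y # Bs)"
      using cons.hyps by (simp add: mono_value_Cons pos_join_mono)
    then show ?case using subset_pos_join_self[of Y] by blast
  qed
qed

text \<open>Every point \<open>d\<close> of the residue of \<open>M\<close> is the centre of a contraction that maps \<open>Y\<close> into the
  value of \<open>M\<close> at \<open>Y\<close>. If that value lies in \<open>Y\<close>, iterating the contraction at \<open>c \<in> Y\<close> shows that
  \<open>Y\<close> contains points of the segment from \<open>c\<close> to \<open>d\<close> arbitrarily close to \<open>d\<close>.\<close>

lemma affine_step_comb:
  assumes "is_comb (Suc k) E" "hd E \<noteq> 1" "d \<in> comb_value (normalized_tl E) Bs" "z \<in> Y"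
  shows "hd E *\<^sub>R z + (1 - hd E) *\<^sub>R d \<in> comb_value E (Y # Bs)" "0 \<le> hd E" "hd E < 1"
proof -
  show r: "0 \<le> hd E" "hd E < 1"
    using is_comb_Cons[OF assms(1)] assms(2) by (metis list.sel(1) order_less_le)+
  show "hd E *\<^sub>R z + (1 - hd E) *\<^sub>R d \<in> comb_value E (Y # Bs)"
  proof (cases "hd E = 0")
    case True
    then show ?thesis using comb_value_hd_zero[OF assms(1) True, of Y Bs] True assms by simp
  next
    case False
    then show ?thesis using comb_value_hd_pos[OF assms(1) _ assms(2), of Y Bs] r assms by auto
  qed
qed

text \<open>Mixing two contractions with weights \<open>s\<close> and \<open>1 - s\<close> gives a
  contraction with factor \<open>s \<mu> + (1 - s) \<nu>\<close>. Its centre is the average of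
  \<open>d\<close> and \<open>e\<close> with weights proportional to \<open>s (1 - \<mu>)\<close>
  and \<open>(1 - s) (1 - \<nu>)\<close>, so a suitable \<open>s\<close> realises any prescribed
  \<open>t\<close>.\<close>

lemma affine_step_pos_join:
  assumes \<mu>: "0 \<le> \<mu>" "\<mu> < 1" "\<And>z. z \<in> Y \<Longrightarrow> \<mu> *\<^sub>R z + (1 - \<mu>) *\<^sub>R d \<in> A"
    and \<nu>: "0 \<le> \<nu>" "\<nu> < 1" "\<And>z. z \<in> Y \<Longrightarrow> \<nu> *\<^sub>R z + (1 - \<nu>) *\<^sub>R e \<in> B"
    and t: "0 < t" "t < 1"
  shows "\<exists>\<kappa>. 0 \<le> \<kappa> \<and> \<kappa> < 1 \<and> (\<forall>z\<in>Y. \<kappa> *\<^sub>R z + (1 - \<kappa>) *\<^sub>R (t *\<^sub>R d + (1 - t) *\<^sub>R e) \<in> pos_join A B)"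
proof -
  \<comment> \<open>The condition on \<open>s\<close> is that \<open>s (1 - \<mu>)\<close> and
    \<open>(1 - s) (1 - \<nu>)\<close> are in the ratio of \<open>t\<close> to \<open>1 - t\<close>.
    Solving it for \<open>s\<close> gives the quotient below, with denominator
    \<open>D\<close>.\<close>
  define D where "D = t * (1 - \<nu>) + (1 - t) * (1 - \<mu>)"
  have D: "0 < t * (1 - \<nu>)" "0 < (1 - t) * (1 - \<mu>)" "0 < D"
    using assms by (simp_all add: D_def add_pos_pos)
  define s where "s = t * (1 - \<nu>) / D"
  define \<kappa> where "\<kappa> = s * \<mu> + (1 - s) * \<nu>"
  have s: "0 < s" "s < 1" using D by (auto simp: s_def D_def)
  have sD: "s * D = t * (1 - \<nu>)" using D by (simp add: s_def)
  have sD': "(1 - s) * D = (1 - t) * (1 - \<mu>)" using sD by (simp add: D_def algebra_simps)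
  have k: "1 - \<kappa> = s * (1 - \<mu>) + (1 - s) * (1 - \<nu>)" by (simp add: \<kappa>_def algebra_simps)
  have kD: "(1 - \<kappa>) * D = (1 - \<mu>) * (1 - \<nu>)"
  proof -
    have "(1 - \<kappa>) * D = (s * D) * (1 - \<mu>) + ((1 - s) * D) * (1 - \<nu>)" unfolding k
      by (simp add: algebra_simps)
    also have "\<dots> = (1 - \<mu>) * (1 - \<nu>)" unfolding sD sD' by (simp add: algebra_simps)
    finally show ?thesis .
  qed
  have kt: "(1 - \<kappa>) * t = s * (1 - \<mu>)"
  proof -
    have "((1 - \<kappa>) * t) * D = (s * (1 - \<mu>)) * D"
      using sD kD by (metis (no_types) mult.assoc mult.commute)
    then show ?thesis using D by simp
  qed
  have kt': "(1 - \<kappa>) * (1 - t) = (1 - s) * (1 - \<nu>)"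
    using kt k by (simp only: right_diff_distrib mult_1_right)
  have "0 \<le> \<kappa>" using s assms by (simp add: \<kappa>_def)
  moreover have "0 < 1 - \<kappa>" using s assms unfolding k by (simp add: add_pos_pos)
  moreover have "\<kappa> *\<^sub>R z + (1 - \<kappa>) *\<^sub>R (t *\<^sub>R d + (1 - t) *\<^sub>R e) \<in> pos_join A B" if "z \<in> Y" for z
  proof -
    have "s *\<^sub>R (\<mu> *\<^sub>R z + (1 - \<mu>) *\<^sub>R d) + (1 - s) *\<^sub>R (\<nu> *\<^sub>R z + (1 - \<nu>) *\<^sub>R e) \<in> pos_join A B"
      using s assms that by (intro pos_joinI) auto
    also have "s *\<^sub>R (\<mu> *\<^sub>R z + (1 - \<mu>) *\<^sub>R d) + (1 - s) *\<^sub>R (\<nu> *\<^sub>R z + (1 - \<nu>) *\<^sub>R e)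
      = \<kappa> *\<^sub>R z + (1 - \<kappa>) *\<^sub>R (t *\<^sub>R d + (1 - t) *\<^sub>R e)"
      unfolding scaleR_add_right scaleR_scaleR kt kt' by (simp add: \<kappa>_def scaleR_add_left)
    finally show ?thesis .
  qed
  ultimately show ?thesis by (intro exI[of _ \<kappa>]) simp
qed

text \<open>Here the second map is the identity, the step contributed by factors equal to the
  variable. Mixing it in with weight 1/2 keeps the centre \<open>d\<close>, and the factor
  \<open>(1 + \<mu>) / 2\<close> stays below 1.\<close>

lemma affine_step_pos_join_self:
  assumes "0 \<le> \<mu>" "\<mu> < 1" "\<And>z. z \<in> Y \<Longrightarrow> \<mu> *\<^sub>R z + (1 - \<mu>) *\<^sub>R d \<in> A" "Y \<subseteq> B"
  shows "\<exists>\<kappa>. 0 \<le> \<kappa> \<and> \<kappa> < 1 \<and> (\<forall>z\<in>Y. \<kappa> *\<^sub>R z + (1 - \<kappa>) *\<^sub>R d \<in> pos_join A B)"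
proof (intro exI conjI ballI)
  fix z assume "z \<in> Y"
  then have "(1/2) *\<^sub>R (\<mu> *\<^sub>R z + (1 - \<mu>) *\<^sub>R d) + (1 - 1/2) *\<^sub>R z \<in> pos_join A B"
    using assms by (intro pos_joinI) auto
  also have "(1/2) *\<^sub>R (\<mu> *\<^sub>R z + (1 - \<mu>) *\<^sub>R d) + (1 - 1/2) *\<^sub>R z
    = ((1 + \<mu>) / 2) *\<^sub>R z + (1 - (1 + \<mu>) / 2) *\<^sub>R d"
    by (simp add: scaleR_add_right add_divide_distrib diff_divide_distrib algebra_simps)
  finally show "((1 + \<mu>) / 2) *\<^sub>R z + (1 - (1 + \<mu>) / 2) *\<^sub>R d \<in> pos_join A B" .
qed (use assms in auto)

text \<open>The contractions of the single factors are combined along the join. A factor, or a whole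
  tail, that consists only of the variable has no centre and acts as the identity.\<close>

lemma affine_step_mono:
  assumes "is_mono (Suc k) M" "residue M \<noteq> []" "d \<in> mono_value (residue M) Bs"
  shows "\<exists>\<mu>. 0 \<le> \<mu> \<and> \<mu> < 1 \<and> (\<forall>z\<in>Y. \<mu> *\<^sub>R z + (1 - \<mu>) *\<^sub>R d \<in> mono_value M (Y # Bs))"
proof -
  have "M \<noteq> []" using assms by (simp add: is_mono_def)
  then show ?thesis using assms
  proof (induction M arbitrary: d rule: list_nonempty_induct)
    case (single E)
    then have "is_comb (Suc k) E" "hd E \<noteq> 1" "d \<in> comb_value (normalized_tl E) Bs"
      by (auto simp: is_mono_def residue_Cons mono_value_single split: if_splits)
    note step = affine_step_comb[OF this]
    \<comment> \<open>\<open>affine_step_comb\<close> gives its bounds on \<open>hd E\<close> only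
      when \<open>Y\<close> has a point. For empty \<open>Y\<close> any factor, such as 0, will
      do.\<close>
    show ?case
    proof (cases "Y = {}")
      case True
      then show ?thesis by (auto intro: exI[of _ 0])
    next
      case False
      then have "0 \<le> hd E" "hd E < 1" using step(2,3) by blast+
      then show ?thesis using step(1) by (auto simp: mono_value_single)
    qed
  next
    case (cons E M)
    have E: "is_comb (Suc k) E" and M: "is_mono (Suc k) M" using cons by (auto simp: is_mono_def)
    note cE = affine_step_comb[OF E]
    show ?case
    proof (cases "Y = {}")
      case True
      then show ?thesis by (auto intro: exI[of _ 0])
    next
      case False
      then obtain y where y: "y \<in> Y" by blast
      note v = mono_value_Cons[OF \<open>M \<noteq> []\<close>]
      show ?thesis
      proof (cases "hd E = 1")
        case True
        then have "residue M \<noteq> []" "d \<in> mono_value (residue M) Bs" using cons.prems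
          by (auto simp: residue_Cons)
        from cons.IH[OF M this] obtain \<mu> where "0 \<le> \<mu>" "\<mu> < 1"
          "\<And>z. z \<in> Y \<Longrightarrow> \<mu> *\<^sub>R z + (1 - \<mu>) *\<^sub>R d \<in> mono_value M (Y # Bs)" by blast
        from affine_step_pos_join_self[OF this, of Y] show ?thesis
          using comb_value_hd_one[OF E True, of Y Bs] by (simp add: v pos_join_commute)
      next
        case r: False
        show ?thesis
        proof (cases "residue M = []")
          case True
          then have d: "d \<in> comb_value (normalized_tl E) Bs"
            using cons.prems r by (simp add: residue_Cons mono_value_single)
          show ?thesis
            using affine_step_pos_join_self[OF cE(2,3)[OF r d y] cE(1)[OF r d]
              pure_mono_value[OF M True]]
            by (simp add: v)
        next
          case False
          then have "d \<in> pos_join (comb_value (normalized_tl E) Bs) (mono_value (residue M) Bs)"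
            using cons.prems r by (simp add: residue_Cons mono_value_Cons)
          then obtain t f e where d: "d = t *\<^sub>R f + (1 - t) *\<^sub>R e" and t: "0 < t" "t < 1"
            and f: "f \<in> comb_value (normalized_tl E) Bs" and e: "e \<in> mono_value (residue M) Bs"
            unfolding pos_join_def by blast
          from cons.IH[OF M False e] obtain \<nu> where \<nu>: "0 \<le> \<nu>" "\<nu> < 1"
            "\<And>z. z \<in> Y \<Longrightarrow> \<nu> *\<^sub>R z + (1 - \<nu>) *\<^sub>R e \<in> mono_value M (Y # Bs)" by blast
          show ?thesis unfolding d v
            by (rule affine_step_pos_join[OF cE(2,3)[OF r f y] cE(1)[OF r f] \<nu> t])
        qed
      qed
    qed
  qed
qed

lemma convex_contracting_join:
  assumes Y: "convex Y" "c \<in> Y" and \<mu>: "0 \<le> \<mu>" "\<mu> < 1"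
    and step: "\<And>z. z \<in> Y \<Longrightarrow> \<mu> *\<^sub>R z + (1 - \<mu>) *\<^sub>R d \<in> Y" and l: "0 < l"  "l < 1"
  shows "l *\<^sub>R c + (1 - l) *\<^sub>R d \<in> Y"
proof -
  have iter: "\<mu> ^ n *\<^sub>R c + (1 - \<mu> ^ n) *\<^sub>R d \<in> Y" for n
  proof (induction n)
    case (Suc n)
    have "\<mu> ^ Suc n *\<^sub>R c + (1 - \<mu> ^ Suc n) *\<^sub>R d
      = \<mu> *\<^sub>R (\<mu> ^ n *\<^sub>R c + (1 - \<mu> ^ n) *\<^sub>R d) + (1 - \<mu>) *\<^sub>R d"
      by (simp add: algebra_simps)
    then show ?case using step[OF Suc] by simp
  qed (simp add: Y)
  obtain n where n: "\<mu> ^ n < l" using real_arch_pow_inv[OF l(1) \<mu>(2)] by blast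
  define m where "m = \<mu> ^ n"
  \<comment> \<open>Since \<open>m < l\<close>, the target lies between \<open>c\<close> and the
    n-th iterate. \<open>u\<close> is the weight of the iterate that makes the coefficient of
    \<open>d\<close> equal to \<open>1 - l\<close>.\<close>
  define u where "u = (1 - l) / (1 - m)"
  have m: "0 \<le> m" "m < l" "m < 1" using \<mu> n l by (auto simp: m_def)
  have u: "0 \<le> u" "u \<le> 1" using m l by (auto simp: u_def)
  have um: "u * (1 - m) = 1 - l" using m by (simp add: u_def)
  have "u *\<^sub>R (m *\<^sub>R c + (1 - m) *\<^sub>R d) + (1 - u) *\<^sub>R c \<in> Y"
    using u by (intro convexD[OF Y(1) iter[of n, folded m_def] Y(2)]) simp_all
  also have "u *\<^sub>R (m *\<^sub>R c + (1 - m) *\<^sub>R d) + (1 - u) *\<^sub>R c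
    = (1 - u * (1 - m)) *\<^sub>R c + (u * (1 - m)) *\<^sub>R d"
    by (simp add: algebra_simps)
  finally show ?thesis unfolding um by simp
qed

text \<open>The value of a head-free \<open>K\<close> does not depend on the variable, so it lies in
  \<open>Y\<close> and provides the starting points \<open>c\<close>. Each point of the residue of
  \<open>M\<close> provides a contraction of \<open>Y\<close> into itself.\<close>

lemma eliminate_least:
  assumes \<phi>: "\<And>M. M \<in> set \<phi> \<Longrightarrow> is_mono (Suc k) M" and Y: "convex Y" "monos_value \<phi> (Y # Bs) \<subseteq> Y"
  shows "convex hull (monos_value (eliminate \<phi>) Bs) \<subseteq> Y"
proof (rule hull_minimal[of _ _ convex])
  have le: "mono_value M (Y # Bs) \<subseteq> Y" if "M \<in> set \<phi>" for M
    using Y that unfolding monos_value_def by blast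
  have "mono_value (residue K @ residue M) Bs \<subseteq> Y" if KM: "K \<in> set \<phi>" "head_free K" "M \<in> set \<phi>"
    for K M
  proof -
    have K: "mono_value (residue K) Bs \<subseteq> Y" "residue K \<noteq> []"
      using mono_value_head_free[OF \<phi>[OF KM(1)] KM(2)] le[OF KM(1)] by auto
    show ?thesis
    proof (cases "residue M = []")
      case False
      have "l *\<^sub>R c + (1 - l) *\<^sub>R d \<in> Y"
        if l: "0 < l" "l < 1" and c: "c \<in> mono_value (residue K) Bs"
          and d: "d \<in> mono_value (residue M) Bs" for l c d
      proof -
        obtain \<mu> where \<mu>: "0 \<le> \<mu>" "\<mu> < 1" "\<forall>z\<in>Y. \<mu> *\<^sub>R z + (1 - \<mu>) *\<^sub>R d \<in> mono_value M (Y # Bs)"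
          using affine_step_mono[OF \<phi>[OF KM(3)] False d] by blast
        then have "\<mu> *\<^sub>R z + (1 - \<mu>) *\<^sub>R d \<in> Y" if "z \<in> Y" for z using le[OF KM(3)] that by blast
        then show ?thesis using K c by (intro convex_contracting_join[OF Y(1) _ \<mu>(1,2) _ l]) auto
      qed
      then show ?thesis using K False by (auto simp: mono_value_append pos_join_def)
    qed (use K in simp)
  qed
  then show "monos_value (eliminate \<phi>) Bs \<subseteq> Y" unfolding monos_value_eliminate by blast
qed (rule Y)

section \<open>The smallest solution\<close>

text \<open>This is Bekic's principle for simultaneous least fixed points: the first inequality is
  solved as a monotone function of the other unknowns and inserted into the rest. Substitution is
  correct only up to hulls, which suffices because all components of a solution are convex.\<close>

lemma solve_least_solution:
  assumes "\<And>\<phi> M. \<phi> \<in> set sys \<Longrightarrow> M \<in> set \<phi> \<Longrightarrow> is_mono (length sys + length Bs) M"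
  shows "solves sys Bs (solve sys Bs) \<and> (\<forall>Ys. solves sys Bs Ys \<longrightarrow> list_all2 (\<subseteq>) (solve sys Bs) Ys)"
  using assms
proof (induction sys Bs rule: solve.induct)
  case (1 Bs)
  then show ?case by (simp add: solves_def)
next
  case (2 \<phi> sys Bs)
  define \<psi> where "\<psi> = eliminate \<phi>"
  define sys' where "sys' = map (poly_subst \<psi>) sys"
  define Xs where "Xs = solve sys' Bs"
  define X where "X = convex hull (monos_value \<psi> (Xs @ Bs))"
  let ?k = "length sys + length Bs"
  have \<phi>: "is_mono (Suc ?k) M" if "M \<in> set \<phi>" for M using 2(2)[of \<phi> M] that by simp
  have \<psi>: "is_mono ?k N" if "N \<in> set \<psi>" for N using \<phi> that unfolding \<psi>_def
    by (rule is_mono_eliminate)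
  have sys: "is_mono (Suc ?k) M" if "\<theta> \<in> set sys" "M \<in> set \<theta>" for \<theta> M using 2(2)[of \<theta> M] that
    by simp
  have mono': "is_mono (length sys' + length Bs) M" if "\<theta> \<in> set sys'" "M \<in> set \<theta>" for \<theta> M
    using is_mono_poly_subst[OF \<psi>] sys that by (fastforce simp: sys'_def)
  have "solves sys' Bs (solve sys' Bs) \<and> (\<forall>Ys. solves sys' Bs Ys \<longrightarrow> list_all2 (\<subseteq>) (solve sys' Bs)
    Ys)"
    by (rule 2(1)[folded \<psi>_def, folded sys'_def]) (rule mono')
  then have Xs: "solves sys' Bs Xs" and least: "\<And>Ys. solves sys' Bs Ys \<Longrightarrow> list_all2 (\<subseteq>) Xs Ys"
    unfolding Xs_def by blast+
  have solve: "solve (\<phi> # sys) Bs = X # Xs"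
    by (simp add: \<psi>_def X_def Xs_def sys'_def Let_def)
  have subst: "convex hull (monos_value (poly_subst \<psi> \<theta>) Cs)
    = convex hull (monos_value \<theta> ((convex hull (monos_value \<psi> Cs)) # Cs))"
    if "\<theta> \<in> set sys" for \<theta> and Cs :: "'a set list" using \<psi> sys[OF that]
      by (rule convex_hull_poly_subst)
  have "solves (\<phi> # sys) Bs (X # Xs)"
  proof -
    have X: "monos_value \<phi> (X # Xs @ Bs) \<subseteq> X"
      using eliminate_solves[of \<phi> ?k, OF \<phi>] unfolding X_def \<psi>_def by blast
    have step: "monos_value \<theta> (X # Xs @ Bs) \<subseteq> Z"
      if "\<theta> \<in> set sys" "convex Z" "monos_value (poly_subst \<psi> \<theta>) (Xs @ Bs) \<subseteq> Z" for \<theta> Z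
    proof -
      have "monos_value \<theta> (X # Xs @ Bs) \<subseteq> convex hull (monos_value (poly_subst \<psi> \<theta>) (Xs @ Bs))"
        unfolding subst[OF that(1)] X_def by (rule hull_subset)
      also have "\<dots> \<subseteq> Z" using that by (simp add: hull_minimal)
      finally show ?thesis .
    qed
    have "list_all2 (\<lambda>\<theta> Z. monos_value \<theta> (X # Xs @ Bs) \<subseteq> Z) sys Xs"
    proof (rule list.rel_mono_strong)
      show "list_all2 (\<lambda>\<theta> Z. monos_value (poly_subst \<psi> \<theta>) (Xs @ Bs) \<subseteq> Z) sys Xs"
        using Xs by (simp add: solves_def sys'_def list_all2_map1)
    qed (use step Xs in \<open>simp add: solves_def\<close>)
    moreover have "convex X" by (simp add: X_def)
    ultimately show ?thesis using X Xs by (simp add: solves_def)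
  qed
  moreover have "list_all2 (\<subseteq>) (X # Xs) Ys" if Ys: "solves (\<phi> # sys) Bs Ys" for Ys
  proof -
    obtain Z Zs where Z: "Ys = Z # Zs" "convex Z" "monos_value \<phi> (Z # Zs @ Bs) \<subseteq> Z"
      using Ys by (auto simp: solves_def list_all2_Cons1)
    have le: "convex hull (monos_value \<psi> (Zs @ Bs)) \<subseteq> Z"
      using eliminate_least[of \<phi> ?k, OF \<phi> Z(2,3)] unfolding \<psi>_def .
    \<comment> \<open>The least first component belonging to \<open>Zs\<close> is contained in
      \<open>Z\<close>, so by monotonicity the tail of any solution also solves the substituted
      system.\<close>
    have step: "monos_value (poly_subst \<psi> \<theta>) (Zs @ Bs) \<subseteq> W"
      if "\<theta> \<in> set sys" "convex W" "monos_value \<theta> (Z # Zs @ Bs) \<subseteq> W" for \<theta> W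
    proof -
      have "monos_value (poly_subst \<psi> \<theta>) (Zs @ Bs)
        \<subseteq> convex hull (monos_value \<theta> ((convex hull (monos_value \<psi> (Zs @ Bs))) # Zs @ Bs))"
        unfolding subst[OF that(1), symmetric] by (rule hull_subset)
      also have "\<dots> \<subseteq> convex hull (monos_value \<theta> (Z # Zs @ Bs))"
        using le by (intro hull_mono monos_value_mono) (simp add: list.rel_refl)
      also have "\<dots> \<subseteq> W" using that by (simp add: hull_minimal)
      finally show ?thesis .
    qed
    have "list_all2 (\<lambda>\<theta> W. monos_value (poly_subst \<psi> \<theta>) (Zs @ Bs) \<subseteq> W) sys Zs"
    proof (rule list.rel_mono_strong)
      show "list_all2 (\<lambda>\<theta> W. monos_value \<theta> (Z # Zs @ Bs) \<subseteq> W) sys Zs"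
        using Ys Z by (simp add: solves_def)
    qed (use step Ys Z in \<open>simp add: solves_def\<close>)
    then have "solves sys' Bs Zs"
      using Ys Z by (simp add: solves_def sys'_def list_all2_map1)
    then have XZ: "list_all2 (\<subseteq>) Xs Zs" by (rule least)
    then have "X \<subseteq> convex hull (monos_value \<psi> (Zs @ Bs))"
      unfolding X_def
        by (intro hull_mono monos_value_mono list_all2_appendI) (simp_all add: list.rel_refl)
    then show ?thesis using le XZ Z by auto
  qed
  ultimately show ?case unfolding solve by blast
qed

section \<open>Membership of the solution in the closed family\<close>

lemma good_closureD:
  assumes "good_closure \<B>"
  shows "{} \<in> \<B>"
    "A \<in> \<B> \<Longrightarrow> B \<in> \<B> \<Longrightarrow> A \<union> B \<in> \<B>"
    "A \<in> \<B> \<Longrightarrow> 0 \<le> r \<Longrightarrow> scale_set r A \<in> \<B>"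
    "A \<in> \<B> \<Longrightarrow> B \<in> \<B> \<Longrightarrow> A + B \<in> \<B>"
    "A \<in> \<B> \<Longrightarrow> B \<in> \<B> \<Longrightarrow> pos_join A B \<in> \<B>"
    "A \<in> \<B> \<Longrightarrow> convex hull A \<in> \<B>"
  using assms unfolding good_closure_def by blast+

text \<open>The empty sum {0} has to be excluded: the family consisting of the empty set alone has
  the good closure property but does not contain {0}.\<close>

lemma good_closure_sum_list:
  assumes "good_closure \<B>"
  shows "set As \<subseteq> \<B> \<Longrightarrow> As \<noteq> [] \<Longrightarrow> sum_list As \<in> \<B>"
proof (induction As rule: induct_list012)
  case (2 A)
  then show ?case by (simp del: set_zero)
next
  case (3 A B As)
  then show ?case using good_closureD(4)[OF assms] by simp
qed simp

lemma good_closure_pos_joins: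
  assumes "good_closure \<B>" "set As \<subseteq> \<B>"
  shows "pos_joins As \<in> \<B>"
  using assms(2)
  by (induction As rule: pos_joins.induct) (use good_closureD(1,5)[OF assms(1)] in auto)

lemma good_closure_UN:
  assumes "good_closure \<B>"
  shows "finite I \<Longrightarrow> (\<And>i. i \<in> I \<Longrightarrow> A i \<in> \<B>) \<Longrightarrow> (\<Union>i\<in>I. A i) \<in> \<B>"
  by (induction I rule: finite_induct) (use good_closureD(1,2)[OF assms] in auto)

text \<open>Coefficients summing to 1 cannot all vanish. Hence neither the closure property nor the
  closure algorithm is ever applied to an empty Minkowski sum.\<close>

lemma positive_terms_nonempty:
  assumes "is_comb k E" "length Bs = k"
  shows "positive_terms E Bs \<noteq> []"
proof
  assume "positive_terms E Bs = []"
  then have "\<forall>(r, B)\<in>set (zip E Bs). \<not> 0 < r" by (auto simp: positive_terms_def filter_empty_conv)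
  then have "E ! i = 0" if "i < k" for i
    using assms that by (fastforce simp: is_comb_def set_zip order.order_iff_strict)
  then have "sum_list E = 0" using assms by (simp add: sum_list_sum_nth is_comb_def)
  then show False using assms by (simp add: is_comb_def)
qed

lemma positive_terms_set:
  "(r, B) \<in> set (positive_terms E Bs) \<Longrightarrow> 0 < r \<and> B \<in> set Bs"
  by (auto simp: positive_terms_def dest: set_zip_rightD)

lemma good_closure_comb_value:
  assumes \<B>: "good_closure \<B>" and E: "is_comb k E" "length Bs = k" and Bs: "set Bs \<subseteq> \<B>"
  shows "comb_value E Bs \<in> \<B>"
proof -
  have "scale_set r B \<in> \<B>" if "(r, B) \<in> set (positive_terms E Bs)" for r B
    using positive_terms_set[OF that] Bs by (auto intro!: good_closureD(3)[OF \<B>])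
  then show ?thesis unfolding comb_value_def
    using positive_terms_nonempty[OF E] by (intro good_closure_sum_list[OF \<B>]) auto
qed

lemma good_closure_mono_value:
  assumes "good_closure \<B>" "is_mono k M" "length Bs = k" "set Bs \<subseteq> \<B>"
  shows "mono_value M Bs \<in> \<B>"
  unfolding mono_value_def using assms
  by (intro good_closure_pos_joins) (auto simp: is_mono_def intro: good_closure_comb_value)

lemma good_closure_convex_hull_monos_value:
  assumes "good_closure \<B>" "\<And>M. M \<in> set \<phi> \<Longrightarrow> is_mono k M" "length Bs = k" "set Bs \<subseteq> \<B>"
  shows "convex hull (monos_value \<phi> Bs) \<in> \<B>"
  unfolding monos_value_def using assms
  by (intro good_closureD(6) good_closure_UN good_closure_mono_value) auto

lemma length_solve [simp]: "length (solve sys Bs) = length sys"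
  by (induction sys Bs rule: solve.induct) (simp_all add: Let_def)

lemma is_mono_eliminate_subst:
  assumes "\<And>\<theta> M. \<theta> \<in> set (\<phi> # sys) \<Longrightarrow> M \<in> set \<theta> \<Longrightarrow> is_mono (Suc k) M"
  shows "N \<in> set (eliminate \<phi>) \<Longrightarrow> is_mono k N"
    "\<theta> \<in> set (map (poly_subst (eliminate \<phi>)) sys) \<Longrightarrow> N \<in> set \<theta> \<Longrightarrow> is_mono k N"
proof -
  show *: "is_mono k N" if "N \<in> set (eliminate \<phi>)" for N
    using _ that by (rule is_mono_eliminate) (use assms[of \<phi>] in simp)
  show "is_mono k N" if "\<theta> \<in> set (map (poly_subst (eliminate \<phi>)) sys)" "N \<in> set \<theta>"
  proof -
    obtain \<theta>' where \<theta>': "\<theta>' \<in> set sys" "N \<in> set (poly_subst (eliminate \<phi>) \<theta>')"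
      using \<open>\<theta> \<in> _\<close> \<open>N \<in> _\<close> by auto
    show ?thesis using * _ \<theta>'(2) by (rule is_mono_poly_subst) (use assms \<theta>' in auto)
  qed
qed

lemma good_closure_solve:
  assumes "good_closure \<B>" "set Bs \<subseteq> \<B>"
    "\<And>\<phi> M. \<phi> \<in> set sys \<Longrightarrow> M \<in> set \<phi> \<Longrightarrow> is_mono (length sys + length Bs) M"
  shows "set (solve sys Bs) \<subseteq> \<B>"
  using assms(2,3)
proof (induction sys Bs rule: solve.induct)
  case (2 \<phi> sys Bs)
  let ?k = "length sys + length Bs"
  let ?sys' = "map (poly_subst (eliminate \<phi>)) sys"
  have mono: "\<And>\<theta> M. \<theta> \<in> set (\<phi> # sys) \<Longrightarrow> M \<in> set \<theta> \<Longrightarrow> is_mono (Suc ?k) M" using 2(3) by simp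
  have Xs: "set (solve ?sys' Bs) \<subseteq> \<B>"
    using is_mono_eliminate_subst(2)[OF mono] by (intro 2(1)[OF 2(2)]) auto
  moreover have "convex hull (monos_value (eliminate \<phi>) (solve ?sys' Bs @ Bs)) \<in> \<B>"
    using assms(1) is_mono_eliminate_subst(1)[OF mono]
    by (rule good_closure_convex_hull_monos_value) (use Xs 2(2) in auto)
  ultimately show ?case by (simp add: Let_def)
qed simp

section \<open>From formal systems to lists of coefficients\<close>

definition enumerates :: "lincomb list list \<Rightarrow> polynomial \<Rightarrow> bool" where
  "enumerates Ms \<phi> \<longleftrightarrow> set ` set Ms = \<phi> \<and> (\<forall>Es\<in>set Ms. distinct Es)"

abbreviation coefficients :: "symb list \<Rightarrow> lincomb list list \<Rightarrow> real list list list" where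
  "coefficients ws \<equiv> map (map (\<lambda>E. map E ws))"

lemma enumerates_exists:
  assumes "\<phi> \<in> polynomials \<Omega>"
  obtains Ms where "enumerates Ms \<phi>"
proof -
  have "\<exists>Es. set Es = M \<and> distinct Es" if "M \<in> \<phi>" for M
    using that assms finite_distinct_list by (auto simp: polynomials_def monomials_def)
  then obtain f where f: "\<And>M. M \<in> \<phi> \<Longrightarrow> set (f M) = M \<and> distinct (f M)" by metis
  obtain Ns where "set Ns = \<phi>" using assms finite_list by (auto simp: polynomials_def)
  then have "enumerates (map f Ns) \<phi>" using f by (auto simp: enumerates_def image_image)
  then show ?thesis using that by blast
qed

lemma comb_value_append:
  "length E = length As \<Longrightarrow> comb_value (E @ F) (As @ Bs) = comb_value E As + comb_value F Bs"
  by (induction E As rule: list_induct2) (simp_all add: ac_simps)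

lemma comb_value_map:
  "distinct ws \<Longrightarrow> comb_value (map E ws) (map S ws) = (\<Sum>\<omega>\<in>{\<omega>\<in>set ws. 0 < E \<omega>}. scale_set (E \<omega>) (S \<omega>))"
proof (induction ws)
  case (Cons w ws)
  have "{\<omega>\<in>set (w # ws). 0 < E \<omega>}
    = (if 0 < E w then insert w {\<omega>\<in>set ws. 0 < E \<omega>} else {\<omega>\<in>set ws. 0 < E \<omega>})"
    by auto
  then show ?case using Cons by simp
qed simp

lemma eval_lincomb_coefficients:
  assumes "distinct vs" "distinct ps"
  shows "eval_lincomb (set vs) (set ps) X P E = comb_value (map E (vs @ ps)) (map X vs @ map P ps)"
  unfolding eval_lincomb_def by (simp add: comb_value_append comb_value_map assms)

text \<open>The values agree exactly, although the sets need not be convex: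
  \<open>enumerates\<close> keeps the factors distinct, so no set is joined with itself because of a
  repeated factor. A repeated monomial is harmless in a union.\<close>

lemma eval_polynomial_coefficients:
  assumes "distinct vs" "distinct ps" "enumerates Ms \<phi>"
  shows "eval_polynomial (set vs) (set ps) X P \<phi>
    = monos_value (coefficients (vs @ ps) Ms) (map X vs @ map P ps)"
proof -
  have "eval_monomial (set vs) (set ps) X P (set Es)
    = mono_value (map (\<lambda>E. map E (vs @ ps)) Es) (map X vs @ map P ps)"
    if "Es \<in> set Ms" for Es
    using eval_monomial_eq[of Es "set Es" "set vs" "set ps" X P] that assms
    by (auto simp: enumerates_def mono_value_def eval_lincomb_coefficients intro!:
      arg_cong[of _ _ pos_joins])
  moreover have "\<phi> = set ` set Ms" using assms(3) by (simp add: enumerates_def)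
  ultimately show ?thesis by (simp add: eval_polynomial_def monos_value_def)
qed

lemma is_mono_coefficients:
  assumes "distinct ws" "enumerates Ms \<phi>" "\<phi> \<in> polynomials (set ws)" "M \<in> set (coefficients ws Ms)"
  shows "is_mono (length ws) M"
proof -
  obtain Es where Es: "Es \<in> set Ms" "M = map (\<lambda>E. map E ws) Es" using assms(4) by auto
  then have "set Es \<in> monomials (set ws)" using assms by (auto simp: enumerates_def polynomials_def)
  then have "Es \<noteq> []" "set Es \<subseteq> CL (set ws)" by (auto simp: monomials_def)
  moreover have "is_comb (length ws) (map E ws)" if "E \<in> CL (set ws)" for E
    using that assms(1) by (auto simp: is_comb_def CL_def sum_list_distinct_conv_sum_set)
  ultimately show ?thesis using Es by (auto simp: is_mono_def)
qed

text \<open>The order of monomials and factors is arbitrary but fixed. The closure statement chooses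
  an enumeration, whereas the algorithm takes the one present in its input; both use the facts
  below.\<close>

locale enumerated_system =
  fixes ps :: "symb list" and I :: system and Mss :: "lincomb list list list"
  assumes distinct_ps: "distinct ps" and system: "is_system (set ps) I"
    and enumerates: "list_all2 (\<lambda>(x, \<phi>) Ms. enumerates Ms \<phi>) I Mss"
begin

abbreviation "vs \<equiv> map fst I"
abbreviation "sys \<equiv> map (coefficients (vs @ ps)) Mss"

lemma set_vs: "set vs = vars I"
  by (simp add: vars_def)

lemma distinct: "distinct vs" "distinct (vs @ ps)"
  using system distinct_ps by (auto simp: is_system_def vars_def)

lemma length_sys: "length Mss = length I"
  using enumerates by (simp add: list_all2_lengthD)

lemma is_mono_sys:
  assumes "\<theta> \<in> set sys" "M \<in> set \<theta>"
  shows "is_mono (length sys + length ps) M"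
proof -
  obtain Ms where Ms: "Ms \<in> set Mss" "\<theta> = coefficients (vs @ ps) Ms" using assms by auto
  then obtain i where i: "i < length I" "Ms = Mss ! i" using length_sys by (metis in_set_conv_nth)
  obtain x \<phi> where x: "I ! i = (x, \<phi>)" by fastforce
  then have "enumerates Ms \<phi>" using enumerates i by (auto simp: list_all2_conv_all_nth)
  moreover have "(x, \<phi>) \<in> set I" using i x by (metis nth_mem)
  then have "\<phi> \<in> polynomials (set (vs @ ps))" using system by (auto simp: is_system_def vars_def)
  ultimately show ?thesis
    using is_mono_coefficients[OF distinct(2)] assms(2) Ms length_sys by fastforce
qed

lemma is_solution_iff: "is_solution (set ps) I P X \<longleftrightarrow> solves sys (map P ps) (map X vs)"
proof -
  have "(\<forall>(x, \<phi>)\<in>set I. eval_polynomial (vars I) (set ps) X P \<phi> \<subseteq> X x) \<longleftrightarrow>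
    list_all2 (\<lambda>(x, \<phi>) Ms. eval_polynomial (vars I) (set ps) X P \<phi> \<subseteq> X x) I Mss"
    using length_sys by (simp add: list_all2_conv_all_nth all_set_conv_all_nth case_prod_beta)
  also have "\<dots>
    \<longleftrightarrow> list_all2 (\<lambda>(x, \<phi>) Ms. monos_value (coefficients (vs @ ps) Ms) (map X vs @ map P ps) \<subseteq> X x)
    I Mss"
  proof -
    have "eval_polynomial (vars I) (set ps) X P (snd (I ! i))
      = monos_value (coefficients (vs @ ps) (Mss ! i)) (map X vs @ map P ps)" if "i < length I"
        for i
    proof -
      have "enumerates (Mss ! i) (snd (I ! i))"
        using enumerates that by (simp add: list_all2_conv_all_nth case_prod_beta)
      then show ?thesis unfolding set_vs[symmetric]
        by (rule eval_polynomial_coefficients[OF distinct(1) distinct_ps])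
    qed
    then show ?thesis using length_sys by (auto simp: list_all2_conv_all_nth case_prod_beta)
  qed
  also have "\<dots> \<longleftrightarrow> list_all2 (\<lambda>\<theta> Y. monos_value \<theta> (map X vs @ map P ps) \<subseteq> Y) sys (map X vs)"
    using length_sys by (simp add: list_all2_conv_all_nth case_prod_beta)
  finally show ?thesis by (auto simp: is_solution_def solves_def vars_def)
qed

lemma smallest_solution_eq_solve:
  assumes "is_smallest_solution (set ps) I P X"
  shows "map X vs = solve sys (map P ps)"
proof -
  let ?Z = "solve sys (map P ps)"
  have mono: "\<And>\<theta> M. \<theta> \<in> set sys \<Longrightarrow> M \<in> set \<theta> \<Longrightarrow> is_mono (length sys + length (map P ps)) M"
    using is_mono_sys by simp
  have "solves sys (map P ps) ?Z \<and> (\<forall>Ys. solves sys (map P ps) Ys \<longrightarrow> list_all2 (\<subseteq>) ?Z Ys)"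
    by (rule solve_least_solution) (rule mono)
  then have Z: "solves sys (map P ps) ?Z"
    and least: "\<And>Ys. solves sys (map P ps) Ys \<Longrightarrow> list_all2 (\<subseteq>) ?Z Ys"
    by blast+
  have 1: "list_all2 (\<subseteq>) ?Z (map X vs)"
    using assms by (intro least) (simp add: is_smallest_solution_def is_solution_iff)
  \<comment> \<open>The computed list is turned into an assignment so that minimality of
    \<open>X\<close> can be applied to it; distinctness of the variables makes the lookup recover
    each entry.\<close>
  define Y where "Y = (\<lambda>x. the (map_of (zip vs ?Z) x))"
  have "length vs = length ?Z" by (simp add: length_sys)
  then have "Y (vs ! i) = ?Z ! i" if "i < length vs" for i
    using that distinct(1) unfolding Y_def by (subst map_of_zip_nth) (simp_all add: length_sys)
  then have Y: "map Y vs = ?Z" by (intro nth_equalityI) (simp_all add: length_sys)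
  have "is_solution (set ps) I P Y" using Z unfolding is_solution_iff Y .
  then have "\<forall>x\<in>vars I. X x \<subseteq> Y x" using assms by (simp add: is_smallest_solution_def)
  then have 2: "list_all2 (\<subseteq>) (map X vs) ?Z"
    unfolding Y[symmetric] by (auto simp: list_all2_conv_all_nth simp flip: set_vs)
  show ?thesis using 2 1 by (rule list_all2_antisym[rotated]) auto
qed

end

lemma enumerated_system_exists:
  assumes "distinct ps" "is_system (set ps) I"
  obtains Mss where "enumerated_system ps I Mss"
proof -
  have "\<exists>Ms. enumerates Ms (snd z)" if "z \<in> set I" for z
  proof -
    have "snd z \<in> polynomials (vars I \<union> set ps)" using assms that by (auto simp: is_system_def)
    then show ?thesis using enumerates_exists by metis
  qed
  then obtain f where "\<And>z. z \<in> set I \<Longrightarrow> enumerates (f z) (snd z)" by metis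
  then have "list_all2 (\<lambda>(x, \<phi>) Ms. enumerates Ms \<phi>) I (map f I)"
    by (auto simp: list_all2_conv_all_nth split: prod.splits) (metis nth_mem snd_conv)
  then show ?thesis using that assms by (simp add: enumerated_system_def)
qed

lemma smallest_solution_closed:
  assumes "good_closure \<B>" "is_system \<Omega>p I" "\<forall>p\<in>\<Omega>p. P p \<in> \<B>" "is_smallest_solution \<Omega>p I P X"
    "x \<in> vars I"
  shows "X x \<in> \<B>"
proof -
  obtain ps where ps: "set ps = \<Omega>p" "distinct ps"
    using assms(2) finite_distinct_list unfolding is_system_def by metis
  obtain Mss where "enumerated_system ps I Mss" using enumerated_system_exists ps assms by metis
  then interpret enumerated_system ps I Mss .
  have "map X vs = solve sys (map P ps)" using smallest_solution_eq_solve ps assms by simp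
  moreover have "set (solve sys (map P ps)) \<subseteq> \<B>"
    using assms(1) by (rule good_closure_solve) (use is_mono_sys ps assms(3) in auto)
  ultimately have "set (map X vs) \<subseteq> \<B>" by simp
  then show ?thesis using assms(5) by (auto simp: vars_def)
qed

section \<open>Programs on lists\<close>

text \<open>The outcome of \<open>exec b p\<close> depends on \<open>b\<close> only through occurrences of \<open>Call\<close> outside \<open>Rec\<close>;
  programs without these can be used as subroutines.\<close>

definition runs :: "prog \<Rightarrow> val \<Rightarrow> val \<Rightarrow> bool" where
  "runs p x y \<longleftrightarrow> (\<forall>b. exec b p x y)"

lemma exec_Is_Pair:
  "exec b p x (Pair_val u v) \<Longrightarrow> exec b (Is_Pair p) x (Num 1)"
  "exec b p x Nil_val \<Longrightarrow> exec b (Is_Pair p) x (Num 0)"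
  using exec.Is_Pair[of b p x "Pair_val u v"] exec.Is_Pair[of b p x Nil_val] by simp_all

lemma runs_Rec: "exec p p x y \<Longrightarrow> runs (Rec p) x y"
  by (simp add: runs_def exec.Rec)

lemma runs_intros:
  "runs Input x x"
  "runs Nil_prog x Nil_val"
  "runs Zero x (Num 0)"
  "runs One x (Num 1)"
  "runs p x u \<Longrightarrow> runs q x v \<Longrightarrow> runs (Pair_prog p q) x (Pair_val u v)"
  "runs p x (Pair_val u v) \<Longrightarrow> runs (First p) x u"
  "runs p x (Pair_val u v) \<Longrightarrow> runs (Second p) x v"
  "runs p x (Num r) \<Longrightarrow> runs q x (Num s) \<Longrightarrow> runs (Add p q) x (Num (r + s))"
  "runs p x (Num r) \<Longrightarrow> runs q x (Num s) \<Longrightarrow> runs (Sub p q) x (Num (r - s))"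
  "runs p x (Num r) \<Longrightarrow> runs q x (Num s) \<Longrightarrow> runs (Mul p q) x (Num (r * s))"
  "runs p x (Num r) \<Longrightarrow> runs q x (Num s) \<Longrightarrow> runs (Less p q) x (bool_val (r < s))"
  "runs p x y \<Longrightarrow> runs q y z \<Longrightarrow> runs (Seq p q) x z"
  unfolding runs_def by (blast intro: exec.intros)+

lemmas runs_Pair = runs_intros(5)
lemmas runs_First = runs_intros(6)
lemmas runs_Second = runs_intros(7)
lemmas runs_Seq = runs_intros(12)

lemma runs_Div:
  "runs p x (Num r) \<Longrightarrow> runs q x (Num s) \<Longrightarrow> s \<noteq> 0 \<Longrightarrow> runs (Div p q) x (Num (r / s))"
  unfolding runs_def by (blast intro: exec.Div)

lemma runs_Cond:
  assumes "runs c x (bool_val P)" "P \<Longrightarrow> runs p x y" "\<not> P \<Longrightarrow> runs q x z"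
  shows "runs (Cond c p q) x (if P then y else z)"
  using assms by (cases P) (auto simp: runs_def intro: exec.Cond_true exec.Cond_false)

definition is_zero_prog :: "prog \<Rightarrow> prog" where
  "is_zero_prog p = Cond (Less p Zero) Zero (Cond (Less Zero p) Zero One)"

lemma runs_is_zero:
  assumes "runs p x (Num r)"
  shows "runs (is_zero_prog p) x (bool_val (r = 0))"
proof -
  have "runs (is_zero_prog p) x (if r < 0 then Num 0 else if 0 < r then Num 0 else Num 1)"
    unfolding is_zero_prog_def by (intro runs_Cond runs_intros assms)
  then show ?thesis by (cases "r = 0") (auto split: if_splits)
qed

text \<open>Right fold over the second component of the input. The first component is an environment: \<open>z\<close>
  receives it alone, and \<open>f\<close> receives \<open>((environment, element), accumulator)\<close>.\<close>

definition fold_prog :: "prog \<Rightarrow> prog \<Rightarrow> prog" where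
  "fold_prog f z = Rec (Cond (Is_Pair (Second Input))
     (Seq (Pair_prog (Pair_prog (First Input) (First (Second Input)))
                     (Seq (Pair_prog (First Input) (Second (Second Input))) Call)) f)
     (Seq (First Input) z))"

text \<open>\<open>R\<close> relates abstract elements to codes, and \<open>Q\<close> is the
  invariant for the suffix already folded. Relations are needed because a set has many descriptions
  and the closure algorithm may return any of them.\<close>

lemma runs_fold_rel:
  assumes "list_all2 R xs cs" and "runs z env a0" "Q [] a0"
    and step: "\<And>x c xs a. R x c \<Longrightarrow> Q xs a \<Longrightarrow>
      \<exists>a'. runs f (Pair_val (Pair_val env c) a) a' \<and> Q (x # xs) a'"
  shows "\<exists>a. runs (fold_prog f z) (Pair_val env (list_val cs)) a \<and> Q xs a"
proof -
  let ?B = "Cond (Is_Pair (Second Input))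
     (Seq (Pair_prog (Pair_prog (First Input) (First (Second Input)))
                     (Seq (Pair_prog (First Input) (Second (Second Input))) Call)) f)
     (Seq (First Input) z)"
  have "\<exists>a. exec ?B ?B (Pair_val env (list_val cs)) a \<and> Q xs a"
    using assms(1)
  proof (induction rule: list_all2_induct)
    case Nil
    have "exec ?B ?B (Pair_val env (list_val [])) a0"
      using assms(2) unfolding runs_def
      by (intro exec.Cond_false exec_Is_Pair(2) exec.intros(17)) (auto intro: exec.intros)
    then show ?case using assms(3) by blast
  next
    case (Cons x xs c cs)
    then obtain a where a: "exec ?B ?B (Pair_val env (list_val cs)) a" "Q xs a" by blast
    obtain a' where a': "runs f (Pair_val (Pair_val env c) a) a'" "Q (x # xs) a'"
      using step[OF Cons(1) a(2)] by blast
    have in_list: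
      "exec b Input (Pair_val env (list_val (c # cs))) (Pair_val env (Pair_val c (list_val cs)))"
      for b
      using exec.Input by simp
    have "exec ?B (Is_Pair (Second Input)) (Pair_val env (list_val (c # cs))) (Num 1)"
      by (rule exec_Is_Pair exec.Second in_list)+
    moreover have "exec ?B (Seq (Pair_prog (First Input) (Second (Second Input))) Call)
      (Pair_val env (list_val (c # cs))) a"
      by (rule exec.Seq exec.Pair exec.First exec.Second in_list exec.Call a(1))+
    then have "exec ?B (Pair_prog (Pair_prog (First Input) (First (Second Input)))
        (Seq (Pair_prog (First Input) (Second (Second Input))) Call))
          (Pair_val env (list_val (c # cs)))
        (Pair_val (Pair_val env c) a)"
      by (intro exec.Pair) (rule exec.First exec.Second in_list)+
    ultimately have "exec ?B ?B (Pair_val env (list_val (c # cs))) a'"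
      using a'(1) unfolding runs_def by (meson exec.Cond_true exec.Seq one_neq_zero)
    then show ?case using a'(2) by blast
  qed
  then show ?thesis unfolding fold_prog_def using runs_Rec by blast
qed

lemma runs_fold:
  assumes "runs z env (e a)"
    and "\<And>x acc. x \<in> set xs \<Longrightarrow> runs f (Pair_val (Pair_val env (d x)) (e acc)) (e (g x acc))"
  shows "runs (fold_prog f z) (Pair_val env (list_val (map d xs))) (e (foldr g xs a))"
proof -
  have "\<exists>v. runs (fold_prog f z) (Pair_val env (list_val (map d xs))) v \<and> v = e (foldr g xs a)"
    by (rule runs_fold_rel[where R = "\<lambda>x c. x \<in> set xs \<and> c = d x" and xs = xs])
       (use assms in \<open>auto simp: list_all2_conv_all_nth\<close>)
  then show ?thesis by blast
qed

definition zip_prog :: prog where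
  "zip_prog = Rec (Cond (Is_Pair (First Input))
     (Pair_prog (Pair_prog (First (First Input)) (First (Second Input)))
                (Seq (Pair_prog (Second (First Input)) (Second (Second Input))) Call))
     Nil_prog)"

lemma runs_zip:
  assumes "length xs = length ys"
  shows "runs zip_prog (Pair_val (list_val xs) (list_val ys)) (list_val (map2 Pair_val xs ys))"
proof -
  let ?B = "Cond (Is_Pair (First Input))
     (Pair_prog (Pair_prog (First (First Input)) (First (Second Input)))
                (Seq (Pair_prog (Second (First Input)) (Second (Second Input))) Call))
     Nil_prog"
  have "exec ?B ?B (Pair_val (list_val xs) (list_val ys)) (list_val (map2 Pair_val xs ys))"
    using assms
  proof (induction xs ys rule: list_induct2)
    case Nil
    show ?case by (simp, intro exec.Cond_false exec_Is_Pair(2)) (auto intro: exec.intros)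
  next
    case (Cons x xs y ys)
    show ?case
      by (simp, rule exec.Cond_true)
         (rule exec_Is_Pair exec.Pair exec.First exec.Second exec.Input exec.Seq exec.Call Cons.IH
           one_neq_zero)+
  qed
  then show ?thesis unfolding zip_prog_def by (rule runs_Rec)
qed

definition map_prog :: "prog \<Rightarrow> prog" where
  "map_prog f = fold_prog (Pair_prog (Seq (First Input) f) (Second Input)) Nil_prog"

lemma runs_map_rel:
  assumes "list_all2 R xs cs" and "\<And>x c. R x c \<Longrightarrow> \<exists>d. runs f (Pair_val env c) d \<and> S x d"
  shows "\<exists>ds. runs (map_prog f) (Pair_val env (list_val cs)) (list_val ds) \<and> list_all2 S xs ds"
proof -
  have "\<exists>a. runs (map_prog f) (Pair_val env (list_val cs)) a \<and> (\<exists>ds. a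
    = list_val ds \<and> list_all2 S xs ds)"
    unfolding map_prog_def
  proof (rule runs_fold_rel[OF assms(1)])
    fix x c xs a
    assume "R x c" and a: "\<exists>ds. a = list_val ds \<and> list_all2 S xs ds"
    then obtain d ds where "runs f (Pair_val env c) d" "S x d" "a = list_val ds" "list_all2 S xs ds"
      using assms(2) by blast
    then show "\<exists>a'. runs (Pair_prog (Seq (First Input) f) (Second Input))
      (Pair_val (Pair_val env c) a) a' \<and>
        (\<exists>ds. a' = list_val ds \<and> list_all2 S (x # xs) ds)"
      by (intro exI[of _ "Pair_val d a"] conjI runs_intros exI[of _ "d # ds"])
        (assumption | simp | rule runs_intros)+
  qed (auto intro: runs_intros exI[of _ "[]"])
  then show ?thesis by blast
qed

lemma runs_map:
  assumes "\<And>x. x \<in> set xs \<Longrightarrow> runs f (Pair_val env (d x)) (e (g x))"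
  shows "runs (map_prog f) (Pair_val env (list_val (map d xs))) (list_val (map e (map g xs)))"
proof -
  have "runs (map_prog f) (Pair_val env (list_val (map d xs)))
    (list_val (map e (foldr (\<lambda>x. (#) (g x)) xs [])))"
    unfolding map_prog_def
    by (rule runs_fold) (auto intro!: runs_intros assms)
  also have "foldr (\<lambda>x. (#) (g x)) xs [] = map g xs" by (induction xs) simp_all
  finally show ?thesis .
qed

definition each_prog :: "prog \<Rightarrow> prog" where
  "each_prog f = Seq (Pair_prog Nil_prog Input) (map_prog (Seq (Second Input) f))"

lemma runs_each_rel:
  assumes "list_all2 R xs cs" and "\<And>x c. R x c \<Longrightarrow> \<exists>d. runs f c d \<and> S x d"
  shows "\<exists>ds. runs (each_prog f) (list_val cs) (list_val ds) \<and> list_all2 S xs ds"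
proof -
  have "\<exists>ds. runs (map_prog (Seq (Second Input) f)) (Pair_val Nil_val (list_val cs)) (list_val ds)
    \<and> list_all2 S xs ds"
    by (rule runs_map_rel[OF assms(1)]) (meson assms(2) runs_intros)
  then show ?thesis unfolding each_prog_def by (meson runs_intros)
qed

lemma runs_each:
  assumes "\<And>x. x \<in> set xs \<Longrightarrow> runs f (d x) (e (g x))"
  shows "runs (each_prog f) (list_val (map d xs)) (list_val (map e (map g xs)))"
  unfolding each_prog_def
  by (rule runs_intros runs_map assms | assumption)+

definition filter_prog :: "prog \<Rightarrow> prog" where
  "filter_prog t = Seq (Pair_prog Nil_prog Input)
     (fold_prog (Cond (Seq (Second (First Input)) t)
       (Pair_prog (Second (First Input)) (Second Input)) (Second Input)) Nil_prog)"

lemma runs_filter: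
  assumes "\<And>x. x \<in> set xs \<Longrightarrow> runs t (d x) (bool_val (P x))"
  shows "runs (filter_prog t) (list_val (map d xs)) (list_val (map d (filter P xs)))"
proof -
  let ?f = "Cond (Seq (Second (First Input)) t) (Pair_prog (Second (First Input)) (Second Input))
    (Second Input)"
  have "runs (fold_prog ?f Nil_prog) (Pair_val Nil_val (list_val (map d xs)))
    (list_val (map d (foldr (\<lambda>x acc. if P x then x # acc else acc) xs [])))"
  proof (rule runs_fold)
    fix x acc assume "x \<in> set xs"
    then have "runs ?f (Pair_val (Pair_val Nil_val (d x)) (list_val (map d acc)))
      (if P x then Pair_val (d x) (list_val (map d acc)) else list_val (map d acc))"
      by (intro runs_Cond) (rule runs_intros assms | assumption)+
    then show "runs ?f (Pair_val (Pair_val Nil_val (d x)) (list_val (map d acc)))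
      (list_val (map d (if P x then x # acc else acc)))" by (simp split: if_splits)
  qed (auto intro: runs_intros)
  also have "foldr (\<lambda>x acc. if P x then x # acc else acc) xs [] = filter P xs"
    by (induction xs) simp_all
  finally show ?thesis unfolding filter_prog_def by (meson runs_intros)
qed

definition append_prog :: prog where
  "append_prog = Seq (Pair_prog (Second Input) (First Input))
     (fold_prog (Pair_prog (Second (First Input)) (Second Input)) Input)"

lemma runs_append_list:
  "runs append_prog (Pair_val (list_val xs) (list_val ys)) (list_val (xs @ ys))"
proof -
  have "runs (fold_prog (Pair_prog (Second (First Input)) (Second Input)) Input)
    (Pair_val (list_val ys) (list_val (map id xs))) (list_val (foldr (#) xs ys))"
    by (rule runs_fold) (auto intro!: runs_intros)
  also have "foldr (#) xs ys = xs @ ys" by (induction xs) simp_all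
  finally show ?thesis unfolding append_prog_def list.map_id by (meson runs_intros)
qed

lemma runs_append:
  "runs append_prog (Pair_val (list_val (map d xs)) (list_val (map d ys)))
    (list_val (map d (xs @ ys)))"
  using runs_append_list by simp

definition concat_prog :: prog where
  "concat_prog = Seq (Pair_prog Nil_prog Input)
     (fold_prog (Seq (Pair_prog (Second (First Input)) (Second Input)) append_prog) Nil_prog)"

lemma runs_concat:
  "runs concat_prog (list_val (map (\<lambda>xs. list_val (map d xs)) xss)) (list_val (map d (concat xss)))"
proof -
  have "runs (fold_prog (Seq (Pair_prog (Second (First Input)) (Second Input)) append_prog)
    Nil_prog)
    (Pair_val Nil_val (list_val (map (\<lambda>xs. list_val (map d xs)) xss)))
      (list_val (map d (foldr (@) xss [])))"
  proof (rule runs_fold)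
    fix xs acc
    show "runs (Seq (Pair_prog (Second (First Input)) (Second Input)) append_prog)
      (Pair_val (Pair_val Nil_val (list_val (map d xs))) (list_val (map d acc)))
        (list_val (map d (xs @ acc)))"
      by (rule runs_intros runs_append)+
  qed (auto intro: runs_intros)
  then show ?thesis unfolding concat_prog_def concat_conv_foldr by (meson runs_intros)
qed

section \<open>Programs on polynomials\<close>

abbreviation comb_val :: "real list \<Rightarrow> val" where
  "comb_val E \<equiv> list_val (map Num E)"

abbreviation mono_val :: "real list list \<Rightarrow> val" where
  "mono_val M \<equiv> list_val (map comb_val M)"

abbreviation monos_val :: "real list list list \<Rightarrow> val" where
  "monos_val \<phi> \<equiv> list_val (map mono_val \<phi>)"

lemma comb_val_hd_tl: "E \<noteq> [] \<Longrightarrow> comb_val E = Pair_val (Num (hd E)) (comb_val (tl E))"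
  by (cases E) simp_all

definition normalize_prog :: prog where
  "normalize_prog = Seq (Pair_prog (Sub One (First Input)) (Second Input))
     (map_prog (Div (Second Input) (First Input)))"

lemma runs_normalize:
  assumes "E \<noteq> []" "hd E \<noteq> 1"
  shows "runs normalize_prog (comb_val E) (comb_val (normalized_tl E))"
  unfolding normalize_prog_def normalized_tl_def comb_val_hd_tl[OF assms(1)]
  by (rule runs_intros runs_map runs_Div)+ (use assms(2) in simp)

text \<open>The filter comes first because normalisation divides by \<open>1 - hd E\<close>, and a
  division by 0 would leave the program without output.\<close>

definition residue_prog :: prog where
  "residue_prog = Seq (filter_prog (Cond (is_zero_prog (Sub One (First Input))) Zero One))
    (each_prog normalize_prog)"

lemma runs_residue:
  assumes "\<And>E. E \<in> set M \<Longrightarrow> E \<noteq> []"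
  shows "runs residue_prog (mono_val M) (mono_val (residue M))"
proof -
  have "runs (Cond (is_zero_prog (Sub One (First Input))) Zero One) (comb_val E)
    (bool_val (hd E \<noteq> 1))"
    if "E \<in> set M" for E
  proof -
    have "runs (Cond (is_zero_prog (Sub One (First Input))) Zero One) (comb_val E) (if 1 - hd E
      = 0 then Num 0 else Num 1)"
      unfolding comb_val_hd_tl[OF assms[OF that]] by (rule runs_Cond runs_is_zero runs_intros)+
    then show ?thesis by (simp split: if_splits)
  qed
  then have "runs (filter_prog (Cond (is_zero_prog (Sub One (First Input))) Zero One)) (mono_val M)
    (mono_val (filter (\<lambda>E. hd E \<noteq> 1) M))" by (rule runs_filter)
  moreover have "runs (each_prog normalize_prog) (mono_val (filter (\<lambda>E. hd E \<noteq> 1) M))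
    (mono_val (residue M))"
    unfolding residue_def using assms by (intro runs_each runs_normalize) auto
  ultimately show ?thesis unfolding residue_prog_def by (rule runs_intros)
qed

definition head_free_prog :: prog where
  "head_free_prog = Seq (Pair_prog Nil_prog Input)
     (fold_prog (Cond (is_zero_prog (First (Second (First Input)))) (Second Input) Zero) One)"

lemma runs_head_free:
  assumes "\<And>E. E \<in> set M \<Longrightarrow> E \<noteq> []"
  shows "runs head_free_prog (mono_val M) (bool_val (head_free M))"
proof -
  let ?f = "Cond (is_zero_prog (First (Second (First Input)))) (Second Input) Zero"
  have "runs (fold_prog ?f One) (Pair_val Nil_val (mono_val M))
    (bool_val (foldr (\<lambda>E b. hd E = 0 \<and> b) M True))"
  proof (rule runs_fold)
    fix E b assume "E \<in> set M"
    note E = comb_val_hd_tl[OF assms[OF this]]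
    have "runs ?f (Pair_val (Pair_val Nil_val (comb_val E)) (bool_val b)) (if hd E
      = 0 then bool_val b else Num 0)"
      unfolding E by (rule runs_Cond runs_is_zero runs_intros)+
    then show "runs ?f (Pair_val (Pair_val Nil_val (comb_val E)) (bool_val b))
      (bool_val (hd E = 0 \<and> b))"
      by (simp split: if_splits)
  qed (simp add: runs_intros)
  also have "foldr (\<lambda>E b. hd E = 0 \<and> b) M True = head_free M"
    unfolding head_free_def by (induction M) simp_all
  finally show ?thesis unfolding head_free_prog_def by (meson runs_intros)
qed

definition products_prog :: prog where
  "products_prog = Seq (Pair_prog (Second Input) (First Input))
     (Seq (map_prog (Seq (Pair_prog (Second Input) (First Input)) (map_prog append_prog)))
       concat_prog)"

lemma runs_products:
  "runs products_prog (Pair_val (monos_val \<phi>) (monos_val \<psi>))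
     (monos_val (concat (map (\<lambda>N. map (\<lambda>N'. N @ N') \<psi>) \<phi>)))"
proof -
  have "runs (map_prog (Seq (Pair_prog (Second Input) (First Input)) (map_prog append_prog)))
     (Pair_val (monos_val \<psi>) (monos_val \<phi>))
       (list_val (map monos_val (map (\<lambda>N. map (\<lambda>N'. N @ N') \<psi>) \<phi>)))"
    by (rule runs_map runs_intros runs_append)+
  moreover have "runs concat_prog (list_val (map monos_val (map (\<lambda>N. map (\<lambda>N'. N @ N') \<psi>) \<phi>)))
    (monos_val (concat (map (\<lambda>N. map (\<lambda>N'. N @ N') \<psi>) \<phi>)))" by (rule runs_concat)
  ultimately show ?thesis unfolding products_prog_def by (meson runs_intros)
qed

definition eliminate_prog :: prog where
  "eliminate_prog
    = Seq (Pair_prog (Seq (filter_prog head_free_prog) (each_prog residue_prog))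
    (each_prog residue_prog))
     products_prog"

lemma runs_eliminate:
  assumes "\<And>M E. M \<in> set \<phi> \<Longrightarrow> E \<in> set M \<Longrightarrow> E \<noteq> []"
  shows "runs eliminate_prog (monos_val \<phi>) (monos_val (eliminate \<phi>))"
proof -
  have res: "runs (each_prog residue_prog) (monos_val \<theta>) (monos_val (map residue \<theta>))"
    if "set \<theta> \<subseteq> set \<phi>" for \<theta>
    using assms that by (intro runs_each runs_residue) blast
  have "runs (Seq (filter_prog head_free_prog) (each_prog residue_prog)) (monos_val \<phi>)
    (monos_val (map residue (filter head_free \<phi>)))"
  proof (rule runs_intros)
    show "runs (filter_prog head_free_prog) (monos_val \<phi>) (monos_val (filter head_free \<phi>))"
      using assms by (intro runs_filter runs_head_free)
  qed (intro res, auto)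
  then have "runs eliminate_prog (monos_val \<phi>)
     (monos_val (concat (map (\<lambda>N. map (\<lambda>N'. N @ N') (map residue \<phi>))
       (map residue (filter head_free \<phi>)))))"
    unfolding eliminate_prog_def
      by (rule runs_Seq[OF runs_Pair[OF _ res[OF subset_refl]] runs_products])
  then show ?thesis by (simp add: eliminate_def o_def)
qed

definition add_scaled_prog :: prog where
  "add_scaled_prog = Seq
     (Pair_prog (First (First Input)) (Seq (Pair_prog (Second Input) (Second (First Input)))
       zip_prog))
     (map_prog (Add (Mul (First Input) (First (Second Input))) (Second (Second Input))))"

lemma runs_add_scaled:
  assumes "length G = length F"
  shows "runs add_scaled_prog (Pair_val (Pair_val (Num r) (comb_val F)) (comb_val G))
    (comb_val (map2 (\<lambda>g e. r * g + e) G F))"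
proof -
  have "runs (map_prog (Add (Mul (First Input) (First (Second Input))) (Second (Second Input))))
    (Pair_val (Num r) (list_val (map (\<lambda>(g, e). Pair_val (Num g) (Num e)) (zip G F))))
      (comb_val (map2 (\<lambda>g e. r * g + e) G F))"
    by (rule runs_map) (auto intro!: runs_intros)
  moreover have "map (\<lambda>(g, e). Pair_val (Num g) (Num e)) (zip G F)
    = map2 Pair_val (map Num G) (map Num F)"
    by (simp add: zip_map_map o_def case_prod_beta)
  ultimately show ?thesis unfolding add_scaled_prog_def
    by (rule_tac runs_Seq) (rule runs_intros runs_zip | simp add: assms)+
qed

definition comb_subst_prog :: prog where
  "comb_subst_prog = Cond (is_zero_prog (First (Second Input)))
     (Pair_prog (Pair_prog (Second (Second Input)) Nil_prog) Nil_prog)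
     (Seq (Pair_prog (Second Input) (First Input)) (map_prog (map_prog add_scaled_prog)))"

lemma runs_comb_subst:
  assumes "length E = Suc k" "\<And>N G. N \<in> set \<psi> \<Longrightarrow> G \<in> set N \<Longrightarrow> length G = k"
  shows "runs comb_subst_prog (Pair_val (monos_val \<psi>) (comb_val E)) (monos_val (comb_subst \<psi> E))"
proof -
  have E: "comb_val E = Pair_val (Num (hd E)) (comb_val (tl E))" "length (tl E) = k"
    using assms(1) by (cases E; simp)+
  have "runs (map_prog (map_prog add_scaled_prog))
    (Pair_val (Pair_val (Num (hd E)) (comb_val (tl E))) (monos_val \<psi>))
     (monos_val (map (map (\<lambda>G. map2 (\<lambda>g e. hd E * g + e) G (tl E))) \<psi>))"
    using assms(2) E(2) by (intro runs_map runs_add_scaled) auto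
  then have "runs comb_subst_prog (Pair_val (monos_val \<psi>) (comb_val E))
    (if hd E = 0 then Pair_val (Pair_val (comb_val (tl E)) Nil_val) Nil_val
     else monos_val (map (map (\<lambda>G. map2 (\<lambda>g e. hd E * g + e) G (tl E))) \<psi>))"
    unfolding comb_subst_prog_def E(1)
      by (intro runs_Cond runs_is_zero) (rule runs_intros | assumption)+
  then show ?thesis by (simp add: comb_subst_def split: if_splits)
qed

definition mono_subst_prog :: prog where
  "mono_subst_prog
    = fold_prog (Seq (Pair_prog (Seq (First Input) comb_subst_prog) (Second Input)) products_prog)
     (Pair_prog Nil_prog Nil_prog)"

lemma runs_mono_subst:
  assumes "\<And>E. E \<in> set M \<Longrightarrow> length E = Suc k" "\<And>N G. N \<in> set \<psi> \<Longrightarrow> G \<in> set N \<Longrightarrow> length G = k"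
  shows "runs mono_subst_prog (Pair_val (monos_val \<psi>) (mono_val M)) (monos_val (mono_subst \<psi> M))"
proof -
  let ?g = "\<lambda>E acc. concat (map (\<lambda>N. map (\<lambda>N'. N @ N') acc) (comb_subst \<psi> E))"
  have "runs mono_subst_prog (Pair_val (monos_val \<psi>) (mono_val M)) (monos_val (foldr ?g M [[]]))"
    unfolding mono_subst_prog_def
  proof (rule runs_fold)
    show "runs (Pair_prog Nil_prog Nil_prog) (monos_val \<psi>) (monos_val [[]])"
      by (simp add: runs_intros)
  next
    fix E acc assume "E \<in> set M"
    then show "runs (Seq (Pair_prog (Seq (First Input) comb_subst_prog) (Second Input))
      products_prog)
      (Pair_val (Pair_val (monos_val \<psi>) (comb_val E)) (monos_val acc)) (monos_val (?g E acc))"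
      using assms by (intro runs_Seq) (rule runs_intros runs_comb_subst runs_products | blast)+
  qed
  also have "foldr ?g M [[]] = mono_subst \<psi> M" by (induction M) simp_all
  finally show ?thesis .
qed

definition poly_subst_prog :: prog where
  "poly_subst_prog = Seq (map_prog mono_subst_prog) concat_prog"

lemma runs_poly_subst:
  assumes "\<And>M E. M \<in> set \<phi> \<Longrightarrow> E \<in> set M \<Longrightarrow> length E = Suc k" "\<And>N G. N \<in> set \<psi> \<Longrightarrow> G \<in> set N \<Longrightarrow> length G
    = k"
  shows "runs poly_subst_prog (Pair_val (monos_val \<psi>) (monos_val \<phi>)) (monos_val (poly_subst \<psi> \<phi>))"
proof -
  have "runs (map_prog mono_subst_prog) (Pair_val (monos_val \<psi>) (monos_val \<phi>))
    (list_val (map monos_val (map (mono_subst \<psi>) \<phi>)))"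
    using assms by (intro runs_map runs_mono_subst) blast+
  then show ?thesis unfolding poly_subst_prog_def poly_subst_def
    by (rule runs_Seq[OF _ runs_concat])
qed

section \<open>The algorithm\<close>

definition positive_terms_prog :: prog where
  "positive_terms_prog = Seq (Pair_prog (Second Input) (First Input)) (Seq zip_prog
     (Seq (filter_prog (Less Zero (First Input)))
       (Pair_prog (each_prog (Second Input)) (each_prog (First Input)))))"

lemma runs_positive_terms:
  assumes "length E = length cs"
  shows "runs positive_terms_prog (Pair_val (list_val cs) (comb_val E))
    (Pair_val (list_val (map snd (positive_terms E cs)))
      (comb_val (map fst (positive_terms E cs))))"
proof -
  let ?d = "\<lambda>(r, c). Pair_val (Num r) c"
  have "map2 Pair_val (map Num E) cs = map ?d (zip E cs)"
    by (simp add: zip_map1 o_def case_prod_beta)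
  then have "runs zip_prog (Pair_val (comb_val E) (list_val cs)) (list_val (map ?d (zip E cs)))"
    using runs_zip[of "map Num E" cs] assms by simp
  moreover have "runs (filter_prog (Less Zero (First Input))) (list_val (map ?d (zip E cs)))
    (list_val (map ?d (positive_terms E cs)))"
    unfolding positive_terms_def
  proof (rule runs_filter)
    fix t
    have "runs (Less Zero (First Input)) (Pair_val (Num (fst t)) (snd t)) (bool_val (0 < fst t))"
      by (rule runs_intros)+
    then show "runs (Less Zero (First Input)) (?d t) (bool_val (case t of (r, c) \<Rightarrow> 0 < r))"
      unfolding case_prod_beta .
  qed
  moreover have "runs (each_prog (Second Input)) (list_val (map ?d ts))
    (list_val (map id (map snd ts)))" for ts
    by (rule runs_each) (clarsimp, (rule runs_intros)+)
  moreover have "runs (each_prog (First Input)) (list_val (map ?d ts))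
    (list_val (map Num (map fst ts)))" for ts
    by (rule runs_each) (clarsimp, (rule runs_intros)+)
  ultimately show ?thesis unfolding positive_terms_prog_def list.map_id
    by (rule_tac runs_Seq) (rule runs_intros | assumption)+
qed

text \<open>The selection depends on the coefficients alone, so sets and their codes are kept at the
  same positions. For this purpose \<open>positive_terms\<close> is polymorphic in its second
  list.\<close>

lemma positive_terms_rel:
  "list_all2 R As Bs \<Longrightarrow> list_all2 (\<lambda>s t. fst s = fst t \<and> R (snd s) (snd t)) (positive_terms E As)
    (positive_terms E Bs)"
proof (induction As Bs arbitrary: E rule: list_all2_induct)
  case (Cons A As B Bs)
  then show ?case by (cases E) (simp_all add: positive_terms_def)
qed (simp add: positive_terms_def)

section \<open>Calls of the closure algorithm\<close>

locale closure_algorithm =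
  fixes bs :: "'v::real_vector list" and \<B> :: "'v set set" and p :: prog
  assumes good: "good_closure \<B>"
    and algorithm: "\<And>Bs rs c. Bs \<noteq> [] \<and> set Bs \<subseteq> \<B> \<and> length rs = length Bs \<and> (\<forall>r\<in>set rs. 0 \<le> r) \<and>
        codes_list (describes bs) Bs c \<Longrightarrow>
        (\<exists>c_union c_sum c_scaled c_join c_hull.
           computes p (Pair_val c (list_val (map Num rs)))
             (list_val [c_union, c_sum, c_scaled, c_join, c_hull]) \<and>
           describes bs (\<Union>(set Bs)) c_union \<and>
           describes bs (sum_list Bs) c_sum \<and>
           codes_list (describes bs) (map2 scale_set rs Bs) c_scaled \<and>
           describes bs (pos_joins Bs) c_join \<and>
           describes bs (convex hull (\<Union>(set Bs))) c_hull)"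
begin

text \<open>The closure algorithm guarantees nothing outside \<open>\<B>\<close>, so membership must
  accompany every intermediate description.\<close>

definition described :: "'v set \<Rightarrow> val \<Rightarrow> bool" where
  "described B c \<longleftrightarrow> B \<in> \<B> \<and> describes bs B c"

text \<open>\<open>computes p\<close> executes \<open>p\<close> with \<open>p\<close> itself as
  recursion body. \<open>Rec p\<close> reproduces this inside any program, so that a
  \<open>Call\<close> in \<open>p\<close> is not captured by the caller.\<close>

definition sum_prog :: prog where "sum_prog = First (Second (Rec p))"
definition scaled_prog :: prog where "scaled_prog = First (Second (Second (Rec p)))"
text \<open>The zeros are dummy scaling coefficients, since the algorithm expects one nonnegative
  number for each set.\<close>

definition join_prog :: prog where
  "join_prog = Seq (Pair_prog Input (each_prog Zero)) (First (Second (Second (Second (Rec p)))))"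
definition hull_prog :: prog where
  "hull_prog = Seq (Pair_prog Input (each_prog Zero))
    (First (Second (Second (Second (Second (Rec p))))))"

lemma described_Bs:
  assumes "list_all2 described Bs cs"
  shows "set Bs \<subseteq> \<B>" "codes_list (describes bs) Bs (list_val cs)"
  using assms by (auto simp: described_def codes_list_def list_all2_conv_all_nth in_set_conv_nth)

lemma runs_algorithm:
  assumes Bs: "list_all2 described Bs cs" "Bs \<noteq> []"
    and rs: "length rs = length Bs" "\<forall>r\<in>set rs. 0 \<le> r"
  obtains u s scs j h where
    "runs (Rec p) (Pair_val (list_val cs) (comb_val rs)) (list_val [u, s, list_val scs, j, h])"
    "described (sum_list Bs) s"  "list_all2 described (map2 scale_set rs Bs) scs"
    "described (pos_joins Bs) j" "described (convex hull (\<Union>(set Bs))) h"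
proof -
  have in_B: "set Bs \<subseteq> \<B>" using described_Bs(1)[OF Bs(1)] .
  obtain u s scs j h
    where 1: "computes p (Pair_val (list_val cs) (comb_val rs))
    (list_val [u, s, list_val scs, j, h])"
    and 2: "describes bs (sum_list Bs) s" "list_all2 (describes bs) (map2 scale_set rs Bs) scs"
      "describes bs (pos_joins Bs) j" "describes bs (convex hull (\<Union>(set Bs))) h"
    using algorithm[of Bs rs "list_val cs"] Bs(2) rs in_B described_Bs(2)[OF Bs(1)]
    by (auto simp: codes_list_def)
  have "runs (Rec p) (Pair_val (list_val cs) (comb_val rs)) (list_val [u, s, list_val scs, j, h])"
    using 1 unfolding computes_def by (rule runs_Rec)
  moreover have "sum_list Bs \<in> \<B>" using good_closure_sum_list[OF good in_B Bs(2)] .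
  moreover have "pos_joins Bs \<in> \<B>" using good_closure_pos_joins[OF good in_B] .
  moreover have "convex hull (\<Union>(set Bs)) \<in> \<B>"
    using good_closure_UN[OF good, of "set Bs" id] in_B by (auto intro: good_closureD(6)[OF good])
  moreover have "set (map2 scale_set rs Bs) \<subseteq> \<B>"
    using in_B rs(2) by (auto intro!: good_closureD(3)[OF good] dest: set_zip_leftD set_zip_rightD)
  then have "list_all2 described (map2 scale_set rs Bs) scs"
    using 2(2) by (rule_tac list.rel_mono_strong[OF 2(2)]) (auto simp: described_def)
  ultimately show ?thesis using that 2 by (simp add: described_def)
qed

lemma runs_zeros: "runs (each_prog Zero) (list_val cs) (comb_val (map (\<lambda>_. 0) cs))"
  using runs_each[of cs Zero id Num "\<lambda>_. 0"] by (simp add: runs_intros)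

lemma runs_join:
  assumes "list_all2 described Bs cs" "Bs \<noteq> []"
  shows "\<exists>c. runs join_prog (list_val cs) c \<and> described (pos_joins Bs) c"
    "\<exists>c. runs hull_prog (list_val cs) c \<and> described (convex hull (\<Union>(set Bs))) c"
proof -
  obtain u s scs j h where
    run: "runs (Rec p) (Pair_val (list_val cs) (comb_val (map (\<lambda>_. 0) cs)))
      (list_val [u, s, list_val scs, j, h])"
    and res: "described (pos_joins Bs) j" "described (convex hull (\<Union>(set Bs))) h"
    by (rule runs_algorithm[OF assms, of "map (\<lambda>_. 0) cs"])
      (simp_all add: list_all2_lengthD[OF assms(1)])
  have input: "runs (Pair_prog Input (each_prog Zero)) (list_val cs)
    (Pair_val (list_val cs) (comb_val (map (\<lambda>_. 0) cs)))"
    by (intro runs_Pair runs_zeros runs_intros(1))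
  note run = run[unfolded list_val.simps]
  show "\<exists>c. runs join_prog (list_val cs) c \<and> described (pos_joins Bs) c"
    using res(1)
      runs_Seq[OF input runs_First[OF runs_Second[OF runs_Second[OF runs_Second[OF run]]]]]
    unfolding join_prog_def by blast
  show "\<exists>c. runs hull_prog (list_val cs) c \<and> described (convex hull (\<Union>(set Bs))) c"
    using res(2)
      runs_Seq[OF input
      runs_First[OF runs_Second[OF runs_Second[OF runs_Second[OF runs_Second[OF run]]]]]]
    unfolding hull_prog_def by blast
qed

text \<open>The algorithm is called twice: the first call scales the sets, the second sums the
  scaled sets. In the second call the coefficients serve only as numbers of the right count.\<close>

definition comb_value_prog :: prog where
  "comb_value_prog = Seq positive_terms_prog (Seq (Pair_prog scaled_prog (Second Input)) sum_prog)"

lemma runs_comb_value: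
  assumes Bs: "list_all2 described Bs cs" and E: "is_comb (length Bs) E"
  shows "\<exists>c. runs comb_value_prog (Pair_val (list_val cs) (comb_val E)) c \<and> described
    (comb_value E Bs) c"
proof -
  define rs where "rs = map fst (positive_terms E Bs)"
  define Bs' where "Bs' = map snd (positive_terms E Bs)"
  define cs' where "cs' = map snd (positive_terms E cs)"
  have rel: "list_all2 (\<lambda>s t. fst s = fst t \<and> described (snd s) (snd t)) (positive_terms E Bs)
    (positive_terms E cs)"
    using Bs by (rule positive_terms_rel)
  then have rs_cs: "map fst (positive_terms E cs) = rs" and Bs': "list_all2 described Bs' cs'"
    unfolding rs_def Bs'_def cs'_def
    by (auto simp: list_all2_conv_all_nth intro: nth_equalityI)
  have ne: "Bs' \<noteq> []" using positive_terms_nonempty[OF E refl] by (simp add: Bs'_def)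
  have rs: "length rs = length Bs'" "\<forall>r\<in>set rs. 0 \<le> r"
    using positive_terms_set[of _ _ E Bs] by (force simp: rs_def Bs'_def)+
  have "length E = length cs" using list_all2_lengthD[OF Bs] E by (simp add: is_comb_def)
  from runs_positive_terms[OF this]
  have run1: "runs positive_terms_prog (Pair_val (list_val cs) (comb_val E))
    (Pair_val (list_val cs') (comb_val rs))"
    by (simp only: rs_cs cs'_def)
  obtain u s scs j h where
    run2: "runs (Rec p) (Pair_val (list_val cs') (comb_val rs))
      (list_val [u, s, list_val scs, j, h])"
    and scs: "list_all2 described (map2 scale_set rs Bs') scs"
    using runs_algorithm[OF Bs' ne rs] by metis
  have scaled: "length rs = length (map2 scale_set rs Bs')" "map2 scale_set rs Bs' \<noteq> []"
    using ne rs(1) by auto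
  obtain u' s' scs' j' h' where
    run3: "runs (Rec p) (Pair_val (list_val scs) (comb_val rs))
      (list_val [u', s', list_val scs', j', h'])"
    and s': "described (sum_list (map2 scale_set rs Bs')) s'"
    using runs_algorithm[OF scs scaled(2,1) rs(2)] by metis
  have "map2 scale_set rs Bs' = map (\<lambda>(r, B). scale_set r B) (positive_terms E Bs)"
    unfolding rs_def Bs'_def zip_map_fst_snd ..
  then have "comb_value E Bs = sum_list (map2 scale_set rs Bs')" by (simp only: comb_value_def)
  moreover have "runs scaled_prog (Pair_val (list_val cs') (comb_val rs)) (list_val scs)"
    unfolding scaled_prog_def using run2[unfolded list_val.simps] by (intro runs_First runs_Second)
  moreover have "runs sum_prog (Pair_val (list_val scs) (comb_val rs)) s'"
    unfolding sum_prog_def using run3[unfolded list_val.simps] by (intro runs_First runs_Second)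
  ultimately show ?thesis unfolding comb_value_prog_def using s' run1
    by (metis runs_Seq runs_Pair runs_Second runs_intros(1))
qed

definition mono_value_prog :: prog where
  "mono_value_prog = Seq (map_prog comb_value_prog) join_prog"

lemma runs_mono_value:
  assumes Bs: "list_all2 described Bs cs" and M: "is_mono (length Bs) M"
  shows "\<exists>c. runs mono_value_prog (Pair_val (list_val cs) (mono_val M)) c \<and> described
    (mono_value M Bs) c"
proof -
  have "\<exists>ds. runs (map_prog comb_value_prog) (Pair_val (list_val cs) (mono_val M)) (list_val ds)
      \<and> list_all2 (\<lambda>E d. described (comb_value E Bs) d) M ds"
    by (rule runs_map_rel[where R = "\<lambda>E c. E \<in> set M \<and> c = comb_val E"])
      (use M runs_comb_value[OF Bs] in \<open>auto simp: list_all2_conv_all_nth is_mono_def\<close>)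
  then obtain ds
    where run: "runs (map_prog comb_value_prog) (Pair_val (list_val cs) (mono_val M)) (list_val ds)"
    and ds: "list_all2 described (map (\<lambda>E. comb_value E Bs) M) ds"
    by (auto simp: list_all2_map1)
  moreover have "map (\<lambda>E. comb_value E Bs) M \<noteq> []" using M by (simp add: is_mono_def)
  ultimately show ?thesis
    using runs_join(1)[OF ds] unfolding mono_value_prog_def mono_value_def by (meson runs_Seq)
qed

text \<open>The closure algorithm accepts only nonempty lists, so that the empty set is described by the
  formula \<open>1 = 0\<close>.\<close>

definition empty_prog :: prog where
  "empty_prog = Pair_prog Zero (Pair_prog (Pair_prog Zero (Pair_prog One Nil_prog)) Nil_prog)"

lemma runs_empty: "\<exists>c. runs empty_prog x c \<and> described {} c"
proof (intro exI conjI)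
  show "runs empty_prog x (qf_val (Eq0 (Const 1)))"
    unfolding empty_prog_def by (simp add: runs_intros)
  show "described {} (qf_val (Eq0 (Const 1)))"
    using good_closureD(1)[OF good]
      by (auto simp: described_def describes_def intro!: exI[of _ "Eq0 (Const 1)"])
qed

definition hull_poly_prog :: prog where
  "hull_poly_prog = Cond (Is_Pair (Second Input)) (Seq (map_prog mono_value_prog) hull_prog)
    empty_prog"

lemma runs_hull_poly:
  assumes Bs: "list_all2 described Bs cs" and \<phi>: "\<And>M. M \<in> set \<phi> \<Longrightarrow> is_mono (length Bs) M"
  shows "\<exists>c. runs hull_poly_prog (Pair_val (list_val cs) (monos_val \<phi>)) c \<and> described
    (convex hull (monos_value \<phi> Bs)) c"
proof (cases \<phi>)
  case Nil
  obtain c where "runs empty_prog (Pair_val (list_val cs) Nil_val) c" "described {} c"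
    using runs_empty by blast
  moreover have "exec b (Is_Pair (Second Input)) (Pair_val (list_val cs) Nil_val) (Num 0)" for b
    by (rule exec_Is_Pair(2) exec.Second exec.Input)+
  ultimately show ?thesis
    using Nil by (auto simp: hull_poly_prog_def monos_value_def runs_def intro!: exI[of _ c]
      exec.Cond_false)
next
  case (Cons M0 \<phi>')
  have "\<exists>ds. runs (map_prog mono_value_prog) (Pair_val (list_val cs) (monos_val \<phi>)) (list_val ds)
      \<and> list_all2 (\<lambda>M d. described (mono_value M Bs) d) \<phi> ds"
    by (rule runs_map_rel[where R = "\<lambda>M c. M \<in> set \<phi> \<and> c = mono_val M"])
      (use \<phi> runs_mono_value[OF Bs] in \<open>auto simp: list_all2_conv_all_nth\<close>)
  then obtain ds
    where run: "runs (map_prog mono_value_prog) (Pair_val (list_val cs) (monos_val \<phi>))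
    (list_val ds)"
    and ds: "list_all2 described (map (\<lambda>M. mono_value M Bs) \<phi>) ds"
    by (auto simp: list_all2_map1)
  obtain c where c: "runs hull_prog (list_val ds) c" "described (convex hull (monos_value \<phi> Bs)) c"
    using runs_join(2)[OF ds] Cons by (auto simp: monos_value_def)
  have "exec b (Is_Pair (Second Input)) (Pair_val (list_val cs) (monos_val \<phi>)) (Num 1)" for b
    unfolding Cons list.map list_val.simps by (rule exec_Is_Pair(1) exec.Second exec.Input)+
  then have "runs hull_poly_prog (Pair_val (list_val cs) (monos_val \<phi>)) c"
    using run c(1) unfolding hull_poly_prog_def runs_def
      by (meson exec.Cond_true exec.Seq one_neq_zero)
  then show ?thesis using c(2) by blast
qed

text \<open>The working value grows from the input to \<open>(\<psi>, input)\<close> and then to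
  \<open>((\<psi>, input), ds)\<close>. Here \<open>\<psi>\<close> is the eliminated polynomial and
  \<open>ds\<close> is the result of the recursive call for the later variables.\<close>

definition solve_prog :: prog where
  "solve_prog = Rec (Cond (Is_Pair (First Input))
     (Seq (Pair_prog (Seq (First (First Input)) eliminate_prog) Input)
     (Seq (Pair_prog Input
        (Seq (Pair_prog (Seq (Pair_prog (First Input) (Second (First (Second Input))))
          (map_prog poly_subst_prog))
                        (Second (Second Input)))
         Call))
     (Pair_prog
        (Seq (Pair_prog (Seq (Pair_prog (Second Input) (Second (Second (First Input))))
          append_prog) (First (First Input)))
          hull_poly_prog)
        (Second Input))))
     Nil_prog)"

lemma runs_solve:
  assumes "list_all2 described Bs cs"
    and "\<And>\<phi> M. \<phi> \<in> set sys \<Longrightarrow> M \<in> set \<phi> \<Longrightarrow> is_mono (length sys + length Bs) M"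
  shows "\<exists>ds. runs solve_prog (Pair_val (list_val (map monos_val sys)) (list_val cs)) (list_val ds)
    \<and> list_all2 described (solve sys Bs) ds"
proof -
  let ?R = "(Seq (Pair_prog (Seq (Pair_prog (First Input) (Second (First (Second Input))))
    (map_prog poly_subst_prog))
                        (Second (Second Input)))
         Call)"
  let ?H = "(Seq (Pair_prog (Seq (Pair_prog (Second Input) (Second (Second (First Input))))
    append_prog) (First (First Input)))
          hull_poly_prog)"
  let ?B = "Cond (Is_Pair (First Input))
     (Seq (Pair_prog (Seq (First (First Input)) eliminate_prog) Input)
     (Seq (Pair_prog Input ?R) (Pair_prog ?H (Second Input)))) Nil_prog"
  \<comment> \<open>The induction concerns the open body, where \<open>Call\<close> still denotes
    \<open>?B\<close>. The outcome becomes independent of the context, as \<open>runs\<close>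
    requires, once \<open>Rec\<close> closes the body.\<close>
  have "\<exists>ds. exec ?B ?B (Pair_val (list_val (map monos_val sys)) (list_val cs)) (list_val ds)
    \<and> list_all2 described (solve sys Bs) ds"
    using assms
  proof (induction sys Bs rule: solve.induct)
    case (1 Bs)
    have "exec ?B ?B (Pair_val (list_val (map monos_val [])) (list_val cs)) (list_val [])"
      by (simp, intro exec.Cond_false exec_Is_Pair(2)) (auto intro: exec.intros)
    then show ?case by (metis list_all2_Nil solve.simps(1))
  next
    case (2 \<phi> sys Bs)
    let ?k = "length sys + length Bs"
    define \<psi> where "\<psi> = eliminate \<phi>"
    define sys' where "sys' = map (poly_subst \<psi>) sys"
    have mono: "\<And>\<theta> M. \<theta> \<in> set (\<phi> # sys) \<Longrightarrow> M \<in> set \<theta> \<Longrightarrow> is_mono (Suc ?k) M" using 2(3) by simp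
    have mono\<psi>: "is_mono ?k N" if "N \<in> set \<psi>" for N
      using mono that unfolding \<psi>_def by (rule is_mono_eliminate_subst(1))
    have mono': "is_mono (length sys' + length Bs) N" if "\<theta> \<in> set sys'" "N \<in> set \<theta>" for \<theta> N
    proof -
      have "is_mono ?k N" using mono that unfolding sys'_def \<psi>_def
        by (rule is_mono_eliminate_subst(2))
      then show ?thesis by (simp add: sys'_def)
    qed
    have "\<exists>ds. exec ?B ?B (Pair_val (list_val (map monos_val sys')) (list_val cs)) (list_val ds)
      \<and> list_all2 described (solve sys' Bs) ds"
      by (rule 2(1)[folded \<psi>_def, folded sys'_def, OF 2(2)]) (rule mono')
    then obtain ds
      where ds: "exec ?B ?B (Pair_val (list_val (map monos_val sys')) (list_val cs)) (list_val ds)"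
      "list_all2 described (solve sys' Bs) ds"
      by blast
    have rel: "list_all2 described (solve sys' Bs @ Bs) (ds @ cs)" using ds(2) 2(2)
      by (rule list_all2_appendI)
    have "length (solve sys' Bs @ Bs) = ?k" by (simp add: sys'_def)
    then obtain d where d: "runs hull_poly_prog (Pair_val (list_val (ds @ cs)) (monos_val \<psi>)) d"
      "described (convex hull (monos_value \<psi> (solve sys' Bs @ Bs))) d"
      using runs_hull_poly[OF rel, of \<psi>] mono\<psi> by metis
    let ?x = "Pair_val (list_val (map monos_val (\<phi> # sys))) (list_val cs)"
    let ?y = "Pair_val (monos_val \<psi>) ?x"
    let ?z = "Pair_val ?y (list_val ds)"
    have elim: "runs eliminate_prog (monos_val \<phi>) (monos_val \<psi>)"
      unfolding \<psi>_def using mono[of \<phi>]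
        by (intro runs_eliminate) (fastforce simp: is_mono_def is_comb_def)
    have subst:
      "runs (map_prog poly_subst_prog) (Pair_val (monos_val \<psi>) (list_val (map monos_val sys)))
      (list_val (map monos_val sys'))"
      unfolding sys'_def
      by (intro runs_map runs_poly_subst[where k = ?k])
         (use mono mono\<psi> in \<open>auto simp: is_mono_def is_comb_def\<close>)
    have x: "exec b Input ?x (Pair_val (Pair_val (monos_val \<phi>) (list_val (map monos_val sys)))
      (list_val cs))" for b
      using exec.Input by simp
    have y: "exec b Input ?y
      (Pair_val (monos_val \<psi>) (Pair_val (Pair_val (monos_val \<phi>) (list_val (map monos_val sys)))
      (list_val cs)))" for b
      using exec.Input by simp
    have "exec ?B (Pair_prog (Seq (First (First Input)) eliminate_prog) Input) ?x ?y"
      by (intro exec.Pair exec.Input exec.Seq)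
        (rule exec.First x elim[unfolded runs_def, rule_format])+
    moreover have "exec ?B (Pair_prog Input ?R) ?y ?z"
      by (intro exec.Pair exec.Input)
         (rule exec.Seq exec.Pair exec.First exec.Second y subst[unfolded runs_def, rule_format]
           exec.Call ds(1))+
    moreover have "runs ?H ?z d"
      by (rule runs_Seq[OF runs_Pair[OF runs_Seq[OF runs_Pair runs_append_list]] d(1)])
        (rule runs_intros)+
    then have "exec ?B (Pair_prog ?H (Second Input)) ?z (list_val (d # ds))"
      unfolding runs_def list_val.simps by (blast intro: exec.intros)
    moreover have "exec ?B (Is_Pair (First Input)) ?x (Num 1)"
      by (rule exec_Is_Pair(1) exec.First x)+
    ultimately have "exec ?B ?B ?x (list_val (d # ds))"
      by (meson exec.Cond_true exec.Seq one_neq_zero)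
    moreover have "list_all2 described (solve (\<phi> # sys) Bs) (d # ds)"
      using d(2) ds(2) by (simp add: \<psi>_def sys'_def Let_def)
    ultimately show ?case by blast
  qed
  then show ?thesis unfolding solve_prog_def using runs_Rec by blast
qed

definition decode_prog :: prog where
  "decode_prog = each_prog (Seq (Second Input) (each_prog (each_prog (each_prog (Second Input)))))"

text \<open>The code of a set already contains an enumeration of it. \<open>Ms\<close> is the one
  that the given code happens to use.\<close>

lemma runs_decode_polynomial:
  assumes "codes_polynomial ws \<phi> c"
  shows "\<exists>Ms. enumerates Ms \<phi> \<and> runs (each_prog (each_prog (each_prog (Second Input)))) c
    (monos_val (coefficients ws Ms))"
proof -
  let ?lin = "\<lambda>E. list_val (map (\<lambda>\<omega>. Pair_val (Num (real \<omega>)) (Num (E \<omega>))) ws)"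
  obtain xs cs
    where xs: "distinct xs" "set xs = \<phi>" "list_all2 (codes_set (codes_lincomb ws)) xs cs" "c
    = list_val cs"
    using assms by (auto simp: codes_polynomial_def codes_set_def codes_list_def)
  have "\<exists>Es. distinct Es \<and> set Es = M \<and> d = list_val (map ?lin Es)"
    if code: "codes_set (codes_lincomb ws) M d" for M d
  proof -
    obtain Es ds where "distinct Es" "set Es = M" "list_all2 (codes_lincomb ws) Es ds" "d
      = list_val ds"
      using code unfolding codes_set_def codes_list_def by blast
    moreover from this have "ds = map ?lin Es"
      by (auto simp: list_all2_conv_all_nth codes_lincomb_def intro: nth_equalityI)
    ultimately show ?thesis by blast
  qed
  then have "list_all2 (\<lambda>M d. \<exists>Es. distinct Es \<and> set Es = M \<and> d = list_val (map ?lin Es)) xs cs"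
    using xs(3) by (simp add: list.rel_mono_strong)
  then have "\<exists>Ms. list_all2 (\<lambda>M Es. distinct Es \<and> set Es = M) xs Ms \<and> cs
    = map (\<lambda>Es. list_val (map ?lin Es)) Ms"
  proof (induction rule: list_all2_induct)
    case (Cons M xs d cs)
    then obtain Es Ms where "distinct Es \<and> set Es = M" "d = list_val (map ?lin Es)"
      "list_all2 (\<lambda>M Es. distinct Es \<and> set Es = M) xs Ms" "cs
        = map (\<lambda>Es. list_val (map ?lin Es)) Ms" by blast
    then show ?case by (intro exI[of _ "Es # Ms"]) simp
  qed simp
  then obtain Ms where Ms: "list_all2 (\<lambda>M Es. distinct Es \<and> set Es = M) xs Ms" "cs
    = map (\<lambda>Es. list_val (map ?lin Es)) Ms"
    by blast
  have "enumerates Ms \<phi>"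
  proof -
    have "map set Ms = xs" "\<forall>Es\<in>set Ms. distinct Es"
      using Ms(1) by (auto simp: list_all2_conv_all_nth in_set_conv_nth intro: nth_equalityI)
    then show ?thesis using xs(2) by (auto simp: enumerates_def)
  qed
  moreover have "runs (each_prog (each_prog (each_prog (Second Input)))) c
    (monos_val (coefficients ws Ms))"
    unfolding xs(4) Ms(2) by (rule runs_each runs_intros)+
  ultimately show ?thesis by blast
qed

lemma runs_decode_system:
  assumes "codes_system ps I c"
  shows "\<exists>Mss. list_all2 (\<lambda>(x, \<phi>) Ms. enumerates Ms \<phi>) I Mss \<and>
    runs decode_prog c (list_val (map (\<lambda>Ms. monos_val (coefficients (map fst I @ ps) Ms)) Mss))"
proof -
  define ws where "ws = map fst I @ ps"
  obtain cs where cs: "c = list_val cs"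
    "list_all2 (\<lambda>(x, \<phi>) d. \<exists>e. codes_polynomial ws \<phi> e \<and> d = Pair_val (Num (real x)) e) I cs"
    using assms by (auto simp: codes_system_def codes_list_def ws_def)
  let ?S = "\<lambda>z d. \<exists>Ms. enumerates Ms (snd z) \<and> d = monos_val (coefficients ws Ms)"
  have "\<exists>ds. runs decode_prog (list_val cs) (list_val ds) \<and> list_all2 ?S I ds"
    unfolding decode_prog_def
  proof (rule runs_each_rel[OF cs(2)])
    fix z d assume "(\<lambda>(x, \<phi>) d. \<exists>e. codes_polynomial ws \<phi> e \<and> d = Pair_val (Num (real x)) e) z d"
    then obtain e where e: "codes_polynomial ws (snd z) e" "d = Pair_val (Num (real (fst z))) e"
      by (cases z) auto
    obtain Ms where "enumerates Ms (snd z)"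
      "runs (each_prog (each_prog (each_prog (Second Input)))) e (monos_val (coefficients ws Ms))"
      using runs_decode_polynomial[OF e(1)] by blast
    then show "\<exists>d'. runs (Seq (Second Input) (each_prog (each_prog (each_prog (Second Input))))) d
      d' \<and> ?S z d'"
      unfolding e(2) using runs_Seq[OF runs_Second[OF runs_intros(1)]] by blast
  qed
  then obtain ds where run: "runs decode_prog (list_val cs) (list_val ds)"
    and ds: "list_all2 ?S I ds" by blast
  from ds have "\<exists>Mss. list_all2 (\<lambda>(x, \<phi>) Ms. enumerates Ms \<phi>) I Mss \<and> ds
    = map (\<lambda>Ms. monos_val (coefficients ws Ms)) Mss"
  proof (induction rule: list_all2_induct)
    case (Cons z zs d ds)
    then obtain Ms Mss where "enumerates Ms (snd z)" "d = monos_val (coefficients ws Ms)"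
      "list_all2 (\<lambda>(x, \<phi>) Ms. enumerates Ms \<phi>) zs Mss" "ds
        = map (\<lambda>Ms. monos_val (coefficients ws Ms)) Mss" by blast
    then show ?case by (intro exI[of _ "Ms # Mss"]) (cases z, simp)
  qed simp
  then show ?thesis using run cs(1) unfolding ws_def by blast
qed

definition main_prog :: prog where
  "main_prog = Seq (Pair_prog (Seq (First Input) decode_prog)
    (Seq (Second Input) (each_prog (Second Input)))) solve_prog"

lemma main_prog_correct:
  assumes "distinct ps" "is_system (set ps) I" "\<forall>p\<in>set ps. P p \<in> \<B>"
    "is_smallest_solution (set ps) I P X"
    "codes_system ps I c" "codes_parameters bs ps P d"
  shows "\<exists>out. computes main_prog (Pair_val c d) out \<and> codes_list (describes bs)
    (map (\<lambda>(x, \<phi>). X x) I) out"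
proof -
  obtain Mss where Mss: "list_all2 (\<lambda>(x, \<phi>) Ms. enumerates Ms \<phi>) I Mss"
    and run1: "runs decode_prog c
      (list_val (map (\<lambda>Ms. monos_val (coefficients (map fst I @ ps) Ms)) Mss))"
    using runs_decode_system[OF assms(5)] by blast
  interpret enumerated_system ps I Mss
    using assms Mss by unfold_locales
  obtain ds where ds: "d = list_val ds"
    "list_all2 (\<lambda>p d. \<exists>e. describes bs (P p) e \<and> d = Pair_val (Num (real p)) e) ps ds"
    using assms(6) by (auto simp: codes_parameters_def codes_list_def)
  have "list_all2 (\<lambda>p d. p \<in> set ps \<and> (\<exists>e. describes bs (P p) e \<and> d = Pair_val (Num (real p)) e))
    ps ds"
    using ds(2) by (auto simp: list_all2_conv_all_nth)
  then have "\<exists>es. runs (each_prog (Second Input)) (list_val ds) (list_val es) \<and> list_all2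
    (\<lambda>p e. described (P p) e) ps es"
  proof (rule runs_each_rel)
    fix x c assume "x \<in> set ps \<and> (\<exists>e. describes bs (P x) e \<and> c = Pair_val (Num (real x)) e)"
    then show "\<exists>e. runs (Second Input) c e \<and> described (P x) e"
      using assms(3) by (auto simp: described_def intro: runs_intros)
  qed
  then obtain es where run2: "runs (each_prog (Second Input)) d (list_val es)"
    and es: "list_all2 described (map P ps) es"
    by (auto simp: list_all2_map1 ds(1))
  obtain out where run3: "runs solve_prog (Pair_val (list_val (map monos_val sys)) (list_val es))
    (list_val out)"
    and out: "list_all2 described (solve sys (map P ps)) out"
    using runs_solve[OF es, of sys] is_mono_sys by auto
  have "runs main_prog (Pair_val c d) (list_val out)"
    unfolding main_prog_def
    by (rule runs_Seq[OF runs_Pair[OF runs_Seq[OF _ run1] runs_Seq[OF _ run2]]])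
       ((rule runs_intros)+, use run3 in \<open>simp add: o_def\<close>)
  moreover have "codes_list (describes bs) (map (\<lambda>(x, \<phi>). X x) I) (list_val out)"
  proof -
    have "map (\<lambda>(x, \<phi>). X x) I = solve sys (map P ps)"
      unfolding smallest_solution_eq_solve[OF assms(4), symmetric] by auto
    then show ?thesis using described_Bs(2)[OF out] by simp
  qed
  ultimately show ?thesis unfolding computes_def runs_def by blast
qed

end

theorem theorem1:
  fixes bs :: "'v::real_vector list"
    and \<B> :: "'v set set"
  assumes basis: "distinct bs" "independent (set bs)" "span (set bs) = UNIV"
    and good: "good_closure \<B>"
  shows "(\<forall>\<Omega>p I P X.
            is_system \<Omega>p I \<and> (\<forall>p\<in>\<Omega>p. P p \<in> \<B>) \<and> is_smallest_solution \<Omega>p I P X \<longrightarrow>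
            (\<forall>x\<in>vars I. X x \<in> \<B>)) \<and>
         (effective_good_closure bs \<B> \<longrightarrow>
          (\<exists>prog. \<forall>ps I P X c d.
            distinct ps \<and> is_system (set ps) I \<and> (\<forall>p\<in>set ps. P p \<in> \<B>) \<and>
            is_smallest_solution (set ps) I P X \<and>
            codes_system ps I c \<and> codes_parameters bs ps P d \<longrightarrow>
            (\<exists>out. computes prog (Pair_val c d) out \<and>
                   codes_list (describes bs) (map (\<lambda>(x, \<phi>). X x) I) out)))"
proof (intro conjI impI)
  show "\<forall>\<Omega>p I P X.
            is_system \<Omega>p I \<and> (\<forall>p\<in>\<Omega>p. P p \<in> \<B>) \<and> is_smallest_solution \<Omega>p I P X \<longrightarrow>
            (\<forall>x\<in>vars I. X x \<in> \<B>)"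
    using smallest_solution_closed[OF good] by blast
next
  assume "effective_good_closure bs \<B>"
  then obtain p where "closure_algorithm bs \<B> p"
    unfolding effective_good_closure_def closure_algorithm_def by blast
  then interpret closure_algorithm bs \<B> p .
  show "\<exists>prog. \<forall>ps I P X c d.
            distinct ps \<and> is_system (set ps) I \<and> (\<forall>p\<in>set ps. P p \<in> \<B>) \<and>
            is_smallest_solution (set ps) I P X \<and>
            codes_system ps I c \<and> codes_parameters bs ps P d \<longrightarrow>
            (\<exists>out. computes prog (Pair_val c d) out \<and>
                   codes_list (describes bs) (map (\<lambda>(x, \<phi>). X x) I) out)"
    using main_prog_correct by blast
qed

end
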